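(* Let $p>0$, $M\in\mathbb N_0$ and $d_{\max}\in\mathbb N_0$. There is a minimal degree $d(p,M,d_{\max})$ such that for every $d\ge d(p,M,d_{\max})$ (with $d_{\max}\le d$) the following holds for the $p$-SOS model on $\mathcal T^d$. Let $\mathcal G^0=\mathcal G^0(d_{\max},d,M)$ be the set of configurations $\omega^0\in\mathbb Z^V$ such that (i) the set of broken edges $D=\{\{v,w\}\in E:\omega^0_v\neq\omega^0_w\}$ satisfies $d_D\le d_{\max}$, and (ii) $\max_{v\sim w}|\omega^0_v-\omega^0_w|\le M$. Then there is a finite $\beta_0=\beta_0(d,p,d_{\max},M)$ such that for all $\beta\ge\beta_0$ there is a family of Gibbs measures $(\mu^{\omega^0}_\beta)_{\omega^0\in\mathcal G^0}$ for the $p$-SOS specification at inverse temperature $\beta$ with the properties: (1) $\omega^0\neq\tau^0$ implies $\mu^{\omega^0}_\beta\neq\mu^{\tau^0}_\beta$; (2) each $\mu^{\omega^0}_\beta$ is extremal in the (convex) set of all Gibbs measures for this specification; (3) there exist constants $c,C>0$ such that for every $v\in V$ and every $k\in\mathbb Z$, $\mu^{\omega^0}_\beta(\sigma_v-\omega^0_v=k)\le C e^{-c\beta|k|^p}$.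
   Context: $\mathcal T^d=(V,E)$ is the Cayley tree of order $d\ge 2$: the infinite tree in which every vertex has exactly $d+1$ neighbours; $v\sim w$ means $\{v,w\}\in E$. Spins $\sigma_v$ take values in $\Omega_0=\mathbb Z$, configuration space $\Omega=\mathbb Z^V$ with product $\sigma$-algebra $\mathcal F$; $\mathcal F_W$ is the $\sigma$-algebra generated by $(\sigma_v)_{v\in W}$. The $p$-SOS model has nearest-neighbour pair potential $\Phi(\omega_v,\omega_w)=|\omega_v-\omega_w|^p$ on each edge. For finite $\Lambda\subset V$ and boundary condition $\tau$, $H_\Lambda(\omega_\Lambda\tau_{\Lambda^c})=\sum_{\{i,j\}\in E,\ \{i,j\}\cap\Lambda\neq\emptyset}\Phi(\xi_i,\xi_j)$ where $\xi=\omega_\Lambda\tau_{\Lambda^c}$ is the concatenated configuration, and the Gibbs specification is $\gamma_\Lambda(\omega_\Lambda\mid\tau)=e^{-\beta H_\Lambda(\omega_\Lambda\tau_{\Lambda^c})}/Z^\tau_\Lambda$. A Gibbs measure is a probability measure $\mu$ on $(\Omega,\mathcal F)$ satisfying the DLR equations $\mu(\sigma_\Lambda=\omega_\Lambda\mid\mathcal F_{\Lambda^c})=\gamma_\Lambda(\omega_\Lambda\mid\cdot)$ $\mu$-a.s. for all finite $\Lambda$ and all $\omega_\Lambda$. For a set of edges $D\subset E$ and $v\in V$, $d_D(v)$ is the number of edges of $D$ incident to $v$, and $d_D=\max_{v\in V}d_D(v)$. *)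

theory Defs
  imports "HOL-Probability.Probability"
begin

text \<open>Vertices: reduced words over the alphabet {0..d} (no two consecutive letters equal),
  i.e. elements of the free product of d+1 copies of Z/2. The root is the empty word,
  which has d+1 children; every other vertex has one parent and d children, so every
  vertex has exactly d+1 neighbours.\<close>

definition cayley_V :: "nat \<Rightarrow> nat list set" where
  "cayley_V d = {xs. set xs \<subseteq> {..d} \<and> successively (\<noteq>) xs}"

text \<open>Oriented edge (parent, child); each unordered edge of the tree arises exactly once.\<close>
definition child_pair :: "nat \<Rightarrow> nat list \<Rightarrow> nat list \<Rightarrow> bool" where
  "child_pair d v w \<longleftrightarrow> v \<in> cayley_V d \<and> w \<in> cayley_V d \<and> (\<exists>a. w = v @ [a])"

definition tree_adj :: "nat \<Rightarrow> nat list \<Rightarrow> nat list \<Rightarrow> bool" where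
  "tree_adj d v w \<longleftrightarrow> child_pair d v w \<or> child_pair d w v"

definition Omega :: "nat \<Rightarrow> (nat list \<Rightarrow> int) measure" where
  "Omega d = PiM (cayley_V d) (\<lambda>_. count_space UNIV)"

definition F_sub :: "nat \<Rightarrow> nat list set \<Rightarrow> (nat list \<Rightarrow> int) set set" where
  "F_sub d W = sigma_sets (space (Omega d))
     {{\<omega> \<in> space (Omega d). \<omega> v \<in> A} | v A. v \<in> W}"

definition merge_cfg :: "nat list set \<Rightarrow> (nat list \<Rightarrow> int) \<Rightarrow> (nat list \<Rightarrow> int) \<Rightarrow> nat list \<Rightarrow> int" where
  "merge_cfg \<Lambda> \<eta> \<tau> = (\<lambda>v. if v \<in> \<Lambda> then \<eta> v else \<tau> v)"

definition H_sos :: "nat \<Rightarrow> real \<Rightarrow> nat list set \<Rightarrow> (nat list \<Rightarrow> int) \<Rightarrow> real" where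
  "H_sos d p \<Lambda> \<xi> =
     (\<Sum>(v, w) \<in> {(v, w). child_pair d v w \<and> (v \<in> \<Lambda> \<or> w \<in> \<Lambda>)}.
        \<bar>real_of_int (\<xi> v - \<xi> w)\<bar> powr p)"

definition gamma_sos :: "nat \<Rightarrow> real \<Rightarrow> real \<Rightarrow> nat list set \<Rightarrow> (nat list \<Rightarrow> int) \<Rightarrow> (nat list \<Rightarrow> int) \<Rightarrow> real" where
  "gamma_sos d p \<beta> \<Lambda> \<eta> \<tau> =
     exp (- \<beta> * H_sos d p \<Lambda> (merge_cfg \<Lambda> \<eta> \<tau>)) /
     (\<Sum>\<^sub>\<infinity>\<eta>' \<in> PiE \<Lambda> (\<lambda>_. UNIV). exp (- \<beta> * H_sos d p \<Lambda> (merge_cfg \<Lambda> \<eta>' \<tau>)))"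

text \<open>DLR equations: mu(sigma_Lambda = eta | F_{Lambda^c}) = gamma_Lambda(eta | .) mu-a.s.,
  written out via the defining property of conditional probability
  (gamma_Lambda(eta | .) is F_{Lambda^c}-measurable, depending only on finitely many spins).\<close>
definition gibbs_sos :: "nat \<Rightarrow> real \<Rightarrow> real \<Rightarrow> (nat list \<Rightarrow> int) measure \<Rightarrow> bool" where
  "gibbs_sos d p \<beta> \<mu> \<longleftrightarrow>
     prob_space \<mu> \<and> sets \<mu> = sets (Omega d) \<and>
     (\<forall>\<Lambda> \<eta> A. finite \<Lambda> \<and> \<Lambda> \<subseteq> cayley_V d \<and> \<eta> \<in> PiE \<Lambda> (\<lambda>_. UNIV) \<and>
        A \<in> F_sub d (cayley_V d - \<Lambda>) \<longrightarrow>
        measure \<mu> ({\<sigma> \<in> space (Omega d). \<forall>v\<in>\<Lambda>. \<sigma> v = \<eta> v} \<inter> A) =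
        (\<integral>\<tau>. indicator A \<tau> * gamma_sos d p \<beta> \<Lambda> \<eta> \<tau> \<partial>\<mu>))"

definition extremal_gibbs_sos :: "nat \<Rightarrow> real \<Rightarrow> real \<Rightarrow> (nat list \<Rightarrow> int) measure \<Rightarrow> bool" where
  "extremal_gibbs_sos d p \<beta> \<mu> \<longleftrightarrow>
     gibbs_sos d p \<beta> \<mu> \<and>
     (\<forall>\<mu>1 \<mu>2 t. gibbs_sos d p \<beta> \<mu>1 \<and> gibbs_sos d p \<beta> \<mu>2 \<and> 0 < t \<and> t < 1 \<and>
        (\<forall>A \<in> sets (Omega d). measure \<mu> A = t * measure \<mu>1 A + (1 - t) * measure \<mu>2 A)
        \<longrightarrow> \<mu>1 = \<mu> \<and> \<mu>2 = \<mu>)"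

definition G0 :: "nat \<Rightarrow> nat \<Rightarrow> nat \<Rightarrow> (nat list \<Rightarrow> int) set" where
  "G0 dmax d M = {\<omega> \<in> PiE (cayley_V d) (\<lambda>_. UNIV).
     (\<forall>v \<in> cayley_V d. card {w. tree_adj d v w \<and> \<omega> v \<noteq> \<omega> w} \<le> dmax) \<and>
     (\<forall>v w. tree_adj d v w \<longrightarrow> \<bar>\<omega> v - \<omega> w\<bar> \<le> int M)}"

end

theory Submission
  imports Defs "HOL-Real_Asymp.Real_Asymp"
begin

text \<open>Write \<open>\<sigma> = \<omega> + u\<close>. If \<open>d\<close> is large, a finitely supported \<open>u\<close> raises the energy of \<open>\<omega>\<close> by at
  least \<open>\<Sum>x. \<bar>u x\<bar> powr p\<close>, because the many unbroken edges outweigh the few broken ones.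
  A Peierls argument then shows, uniformly in the finite volume with boundary condition \<open>\<omega>\<close>, that
  \<open>u\<close> is non-zero on a given finite set \<open>S\<close> with probability at most \<open>\<epsilon> ^ card S\<close>, with \<open>\<epsilon>\<close> small
  for large \<open>\<beta>\<close>. A subsequential limit \<open>\<mu>\<close> inherits this bound and the DLR equations.

  For extremality let \<open>\<nu>\<close> be a Gibbs measure dominated by a multiple of \<open>\<mu>\<close>. Two independent
  configurations with laws \<open>\<mu>\<close> and \<open>\<nu>\<close> are exchanged on the region around the root that is cut off
  from infinity by vertices where both agree with \<open>\<omega>\<close>. This preserves the product law, so \<open>\<mu>\<close>
  and \<open>\<nu>\<close> differ on local events by at most the probability that deviations from \<open>\<omega>\<close> reach far
  from the root, and this probability tends to zero.\<close>

subsection \<open>Excess energy on the Cayley tree\<close>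

text \<open>Since \<open>p\<close> may be any positive number, convexity and the triangle inequality
  are replaced by (x + y)^p \<le> 2^p (x^p + y^p); this is the source of \<open>2 powr p\<close> in
  the condition on \<open>d\<close>. That condition leaves one full copy of the sum of |u x|^p as
  net gain, so single-site decay comes out with c = 1.

  Heights are unbounded, so finite-volume laws could lose mass in the limit. The Peierls bound for
  prescribed values dominates each finite marginal, uniformly in the volume, by a multiple of one
  product law; this is the tightness that is used.

  Extremality is defined through convex decompositions, so a competing \<nu> with weight t satisfies
  \<nu> \<le> \<mu> / t. If deviations reach far, some branch of k + 1 sites has a deviation of one
  of the two copies at every site. Charging each site to a copy gives 2^(k+1) cases, each of
  probability at most C \<epsilon>^(k+1). Against at most (d+1)^n branches ending at level n, the
  condition 4 \<epsilon> (d+1) \<le> 1 forces decay in k, and it dictates the choice of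
  \<open>\<theta>\<close> at the end.\<close>

lemma powr_add_le:
  fixes x y p :: real
  assumes "x \<ge> 0" "y \<ge> 0" "p > 0"
  shows "(x + y) powr p \<le> 2 powr p * (x powr p + y powr p)"
proof -
  have "(x + y) powr p \<le> (2 * max x y) powr p"
    using assms by (intro powr_mono2) auto
  also have "\<dots> = 2 powr p * max x y powr p"
    using assms by (simp add: powr_mult)
  also have "max x y powr p \<le> x powr p + y powr p"
    by (auto simp: max_def)
  finally show ?thesis by simp
qed

lemma one_le_int_powr:
  fixes k :: int and p :: real
  assumes "k \<noteq> 0" "p > 0"
  shows "1 \<le> \<bar>real_of_int k\<bar> powr p"
proof -
  have "1 \<le> \<bar>real_of_int k\<bar>" using assms by linarith
  with assms(2) show ?thesis by (simp add: ge_one_powr_ge_zero)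
qed

section \<open>The tree of reduced words and the locality of the energy\<close>

definition tree_ball :: "nat \<Rightarrow> nat \<Rightarrow> nat list set" where
  "tree_ball d n = {x \<in> cayley_V d. length x \<le> n}"

definition touching_edges :: "nat \<Rightarrow> nat list set \<Rightarrow> (nat list \<times> nat list) set" where
  "touching_edges d A = {(v, w). child_pair d v w \<and> (v \<in> A \<or> w \<in> A)}"

lemma cayley_V_snoc:
  "v @ [a] \<in> cayley_V d \<longleftrightarrow> v \<in> cayley_V d \<and> a \<le> d \<and> (v = [] \<or> a \<noteq> last v)"
  by (auto simp: cayley_V_def successively_append_iff)

lemma take_cayley_V: "x \<in> cayley_V d \<Longrightarrow> take j x \<in> cayley_V d"
proof -
  assume "x \<in> cayley_V d"
  then have "set (take j x) \<subseteq> {..d}" "successively (\<noteq>) (take j x @ drop j x)"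
    using set_take_subset[of j x] by (auto simp: cayley_V_def)
  then show ?thesis
    by (auto simp only: cayley_V_def successively_append_iff mem_Collect_eq)
qed

lemma finite_tree_ball [simp]: "finite (tree_ball d n)"
proof (rule finite_subset)
  show "tree_ball d n \<subseteq> {xs. set xs \<subseteq> {..d} \<and> length xs \<le> n}"
    by (auto simp: tree_ball_def cayley_V_def)
qed (simp add: finite_lists_length_le)

lemma tree_ball_mono: "m \<le> n \<Longrightarrow> tree_ball d m \<subseteq> tree_ball d n"
  by (auto simp: tree_ball_def)

lemma tree_ball_subset: "tree_ball d n \<subseteq> cayley_V d"
  by (auto simp: tree_ball_def)

lemma finite_subset_tree_ball:
  assumes "finite A" "A \<subseteq> cayley_V d"
  obtains n where "A \<subseteq> tree_ball d n"
proof
  show "A \<subseteq> tree_ball d (Max (length ` A))"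
    using assms by (auto simp: tree_ball_def)
qed

lemma tree_adj_tree_ball: "x \<in> tree_ball d n \<Longrightarrow> tree_adj d x y \<Longrightarrow> y \<in> tree_ball d (Suc n)"
  by (auto simp: tree_ball_def tree_adj_def child_pair_def)

lemma tree_neighbours_subset:
  "{y. tree_adj d x y} \<subseteq> insert (butlast x) ((\<lambda>a. x @ [a]) ` {a. a \<le> d \<and> (x = [] \<or> a \<noteq> last x)})"
  by (auto simp: tree_adj_def child_pair_def cayley_V_snoc)

lemma finite_tree_neighbours [simp]: "finite {y. tree_adj d x y}"
  by (rule finite_subset[OF tree_neighbours_subset]) auto

text \<open>One parent and at most \<open>d + 1\<close> appended letters are counted separately. The
  root has no parent and other vertices have only \<open>d\<close> children, so the true degree is
  smaller by one; the crude count avoids that case distinction.\<close>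

lemma card_tree_neighbours: "card {y. tree_adj d x y} \<le> d + 2"
proof -
  let ?C = "(\<lambda>a. x @ [a]) ` {a. a \<le> d \<and> (x = [] \<or> a \<noteq> last x)}"
  have "card ?C \<le> card {..d}"
    by (rule order_trans[OF card_image_le card_mono]) auto
  moreover have "card {y. tree_adj d x y} \<le> card (insert (butlast x) ?C)"
    by (intro card_mono tree_neighbours_subset) auto
  moreover have "card (insert (butlast x) ?C) \<le> Suc (card ?C)"
    by (simp add: card_insert_if)
  ultimately show ?thesis by simp
qed

lemma card_children:
  assumes "v \<in> cayley_V d"
  shows "d \<le> card {w. child_pair d v w}" "finite {w. child_pair d v w}"
proof -
  let ?S = "{a. a \<le> d \<and> (v = [] \<or> a \<noteq> last v)}"
  have eq: "{w. child_pair d v w} = (\<lambda>a. v @ [a]) ` ?S"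
    using assms cayley_V_snoc[of v _ d] by (auto simp: child_pair_def)
  have "{..d} - {last v} \<subseteq> ?S" by auto
  then have "card ({..d} - {last v}) \<le> card ?S"
    by (intro card_mono) auto
  moreover have "d \<le> card ({..d} - {last v})"
    by (simp add: card_Diff_singleton_if)
  moreover have "card ((\<lambda>a. v @ [a]) ` ?S) = card ?S"
    by (intro card_image) (auto simp: inj_on_def)
  ultimately show "d \<le> card {w. child_pair d v w}" using eq by simp
  show "finite {w. child_pair d v w}" unfolding eq by simp
qed

lemma finite_touching_edges:
  assumes "finite A"
  shows "finite (touching_edges d A)"
proof (rule finite_subset)
  show "touching_edges d A \<subseteq> (\<Union>x\<in>A. {x} \<times> {y. tree_adj d x y} \<union> {y. tree_adj d x y} \<times> {x})"
    by (auto simp: touching_edges_def tree_adj_def)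
qed (use assms in auto)

lemma H_sos_alt:
  "H_sos d p A \<xi> = (\<Sum>(v, w) \<in> touching_edges d A. \<bar>real_of_int (\<xi> v - \<xi> w)\<bar> powr p)"
  by (simp add: H_sos_def touching_edges_def)

lemma H_sos_cong:
  assumes "\<And>x. x \<in> A \<Longrightarrow> \<xi> x = \<xi>' x"
    and "\<And>x y. x \<in> A \<Longrightarrow> tree_adj d x y \<Longrightarrow> \<xi> y = \<xi>' y"
  shows "H_sos d p A \<xi> = H_sos d p A \<xi>'"
  unfolding H_sos_alt
proof (rule sum.cong[OF refl], safe)
  fix v w assume "(v, w) \<in> touching_edges d A"
  then have "\<xi> v = \<xi>' v \<and> \<xi> w = \<xi>' w"
    using assms by (auto simp: touching_edges_def tree_adj_def)
  then show "\<bar>real_of_int (\<xi> v - \<xi> w)\<bar> powr p = \<bar>real_of_int (\<xi>' v - \<xi>' w)\<bar> powr p"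
    by simp
qed

text \<open>An edge that meets \<open>B\<close> but not \<open>A\<close> sees equal values in both
  configurations and cancels. Energy differences can therefore be computed on any set that contains
  all changed sites.\<close>

lemma H_sos_diff_local:
  assumes "finite B" "A \<subseteq> B" "\<And>x. x \<notin> A \<Longrightarrow> \<xi> x = \<xi>' x"
  shows "H_sos d p B \<xi> - H_sos d p B \<xi>' = H_sos d p A \<xi> - H_sos d p A \<xi>'"
proof -
  let ?f = "\<lambda>\<xi> (v, w). \<bar>real_of_int (\<xi> v - \<xi> w)\<bar> powr p"
  have sub: "touching_edges d A \<subseteq> touching_edges d B"
    using assms(2) by (auto simp: touching_edges_def)
  have split: "H_sos d p B \<zeta> = sum (?f \<zeta>) (touching_edges d B - touching_edges d A) + H_sos d p A \<zeta>" for \<zeta>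
    unfolding H_sos_alt by (intro sum.subset_diff sub finite_touching_edges assms)
  have "sum (?f \<xi>) (touching_edges d B - touching_edges d A)
      = sum (?f \<xi>') (touching_edges d B - touching_edges d A)"
  proof (intro sum.cong refl)
    fix e assume "e \<in> touching_edges d B - touching_edges d A"
    then obtain v w where "e = (v, w)" "v \<notin> A" "w \<notin> A"
      by (auto simp: touching_edges_def)
    then show "?f \<xi> e = ?f \<xi>' e" using assms(3) by simp
  qed
  with split show ?thesis by simp
qed

text \<open>Every vertex \<open>v\<close> with \<open>u v \<noteq> 0\<close> has at least \<open>d - dmax\<close> unbroken edges to its children;
  on each of them either the height difference or \<open>u\<close> at the child pays for \<open>u v\<close>.
  Since every vertex is the child of at most one vertex, the second kind of payment is made
  at most once, and the broken edges cost at most \<open>dmax * M powr p\<close> per vertex.\<close>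

lemma excess_energy:
  fixes u :: "nat list \<Rightarrow> int" and p :: real
  assumes p: "p > 0" and \<omega>: "\<omega> \<in> G0 dmax d M" and A: "finite A" "A \<subseteq> cayley_V d"
    and nz: "\<And>x. x \<in> A \<Longrightarrow> u x \<noteq> 0" and z: "\<And>x. x \<notin> A \<Longrightarrow> u x = 0"
    and d: "real d \<ge> real dmax + 2 powr p * (2 + real dmax * real M powr p)"
  shows "(\<Sum>x\<in>A. \<bar>real_of_int (u x)\<bar> powr p)
    \<le> H_sos d p A (\<lambda>x. \<omega> x + u x) - H_sos d p A \<omega>"
proof -
  let ?n = "\<lambda>k::int. \<bar>real_of_int k\<bar> powr p"
  define E where "E = touching_edges d A"
  define good where "good = {(v, w) \<in> E. \<omega> v = \<omega> w}"
  define bad where "bad = {(v, w) \<in> E. \<omega> v \<noteq> \<omega> w}"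
  define GC where "GC v = {w. child_pair d v w \<and> \<omega> v = \<omega> w}" for v
  define f where "f = (\<lambda>(v, w). ?n (\<omega> v + u v - (\<omega> w + u w)) - ?n (\<omega> v - \<omega> w))"
  define S where "S = (\<Sum>x\<in>A. ?n (u x))"
  have finE: "finite E" unfolding E_def by (rule finite_touching_edges[OF A(1)])
  have deg: "card {w. tree_adj d v w \<and> \<omega> v \<noteq> \<omega> w} \<le> dmax" if "v \<in> A" for v
    using \<omega> that A(2) by (auto simp: G0_def)
  have lip: "\<bar>\<omega> v - \<omega> w\<bar> \<le> int M" if "child_pair d v w" for v w
    using \<omega> that by (auto simp: G0_def tree_adj_def)
  have finGC: "finite (GC v)" if "v \<in> A" for v
    using card_children(2)[of v d] A(2) that by (auto simp: GC_def)
  have cardGC: "real d - real dmax \<le> real (card (GC v))" if "v \<in> A" for v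
  proof -
    have v: "v \<in> cayley_V d" using that A(2) by auto
    let ?b = "{w. child_pair d v w \<and> \<omega> v \<noteq> \<omega> w}"
    have "{w. child_pair d v w} = GC v \<union> ?b" by (auto simp: GC_def)
    then have "d \<le> card (GC v) + card ?b"
      using card_children(1)[OF v] card_Un_le[of "GC v" ?b] by simp
    moreover have "card ?b \<le> card {w. tree_adj d v w \<and> \<omega> v \<noteq> \<omega> w}"
      by (rule card_mono) (auto simp: tree_adj_def intro: finite_subset[OF _ finite_tree_neighbours[of d v]])
    ultimately show ?thesis using deg[OF that] by simp
  qed
  \<comment> \<open>Heights are integers, so each site of \<open>A\<close> contributes at least 1 to
    \<open>S\<close>. This turns a count of broken edges into a multiple of
    \<open>S\<close>.\<close>
  have A_le: "real (card A) \<le> S"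
    unfolding S_def using sum_mono[of A "\<lambda>_. 1::real" "\<lambda>x. ?n (u x)"] one_le_int_powr[OF nz p]
    by simp
  have bad_sum: "- (real dmax * real M powr p * S) \<le> sum f bad"
  proof -
    \<comment> \<open>Each broken edge is charged to an endpoint in \<open>A\<close>, which has at
      most \<open>dmax\<close> broken edges; the conditional restores the orientation from parent to
      child.\<close>
    have bad_sub: "bad \<subseteq> (\<Union>x\<in>A. (\<lambda>y. if child_pair d x y then (x, y) else (y, x))
        ` {y. tree_adj d x y \<and> \<omega> x \<noteq> \<omega> y})"
    proof safe
      fix v w assume "(v, w) \<in> bad"
      then have vw: "child_pair d v w" "v \<in> A \<or> w \<in> A" "\<omega> v \<noteq> \<omega> w"
        by (auto simp: bad_def E_def touching_edges_def)
      then have "\<not> child_pair d w v" by (auto simp: child_pair_def)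
      then show "(v, w) \<in> (\<Union>x\<in>A. (\<lambda>y. if child_pair d x y then (x, y) else (y, x))
        ` {y. tree_adj d x y \<and> \<omega> x \<noteq> \<omega> y})"
        using vw by (auto simp: tree_adj_def image_iff)
    qed
    have "card bad \<le> card (\<Union>x\<in>A. (\<lambda>y. if child_pair d x y then (x, y) else (y, x))
        ` {y. tree_adj d x y \<and> \<omega> x \<noteq> \<omega> y})"
      by (intro card_mono bad_sub finite_UN_I A finite_imageI)
         (auto intro: finite_subset[OF _ finite_tree_neighbours])
    also have "\<dots> \<le> (\<Sum>x\<in>A. card ((\<lambda>y. if child_pair d x y then (x, y) else (y, x))
        ` {y. tree_adj d x y \<and> \<omega> x \<noteq> \<omega> y}))"
      by (rule card_UN_le[OF A(1)])
    also have "\<dots> \<le> (\<Sum>x\<in>A. dmax)"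
    proof (rule sum_mono)
      fix x assume "x \<in> A"
      have "finite {y. tree_adj d x y \<and> \<omega> x \<noteq> \<omega> y}"
        by (auto intro: finite_subset[OF _ finite_tree_neighbours[of d x]])
      from card_image_le[OF this] deg[OF \<open>x \<in> A\<close>]
      show "card ((\<lambda>y. if child_pair d x y then (x, y) else (y, x))
        ` {y. tree_adj d x y \<and> \<omega> x \<noteq> \<omega> y}) \<le> dmax"
        by (rule order_trans)
    qed
    finally have "card bad \<le> dmax * card A" by (simp add: mult.commute)
    then have "real (card bad) \<le> real dmax * real (card A)"
      by (metis of_nat_le_iff of_nat_mult)
    also have "\<dots> \<le> real dmax * S" by (intro mult_left_mono A_le) simp
    finally have cb: "real (card bad) \<le> real dmax * S" .
    have "- (real M powr p) \<le> f e" if eb: "e \<in> bad" for e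
    proof -
      obtain v w where e: "e = (v, w)" "child_pair d v w"
        using eb by (auto simp: bad_def E_def touching_edges_def)
      have "?n (\<omega> v - \<omega> w) \<le> real M powr p"
        using lip[OF e(2)] p by (intro powr_mono2) auto
      moreover have "0 \<le> ?n (\<omega> v + u v - (\<omega> w + u w))" by simp
      ultimately show ?thesis unfolding f_def e(1) prod.case by linarith
    qed
    then have "(\<Sum>e\<in>bad. - (real M powr p)) \<le> sum f bad" by (intro sum_mono)
    moreover have "real (card bad) * real M powr p \<le> real dmax * S * real M powr p"
      using cb by (rule mult_right_mono) simp
    ultimately show ?thesis by (simp add: algebra_simps)
  qed
  have good_sum: "((real d - real dmax) / 2 powr p - 1) * S \<le> sum f good"
  proof -
    \<comment> \<open>\<open>G\<close> keeps the unbroken edges whose parent lies in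
      \<open>A\<close>. On the remaining unbroken edges the energy change is nonnegative, so they
      may be dropped.\<close>
    define G where "G = Sigma A GC"
    have G: "finite G" unfolding G_def using A(1) finGC by auto
    have "G \<subseteq> good" by (auto simp: G_def good_def GC_def E_def touching_edges_def)
    have gpos: "0 \<le> f e" if "e \<in> good" for e
      using that by (auto simp: good_def f_def)
    have "sum f G \<le> sum f good"
      by (rule sum_mono2[OF finite_subset[OF _ finE] \<open>G \<subseteq> good\<close>])
         (use gpos in \<open>auto simp: good_def\<close>)
    moreover have "(\<Sum>(v, w)\<in>G. ?n (u v) / 2 powr p - ?n (u w)) \<le> sum f G"
    proof (rule sum_mono)
      fix e assume "e \<in> G"
      then obtain v w where e: "e = (v, w)" "\<omega> v = \<omega> w" by (auto simp: G_def GC_def)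
      have "?n (u v) \<le> (\<bar>real_of_int (u v - u w)\<bar> + \<bar>real_of_int (u w)\<bar>) powr p"
        using p by (intro powr_mono2) auto
      also have "\<dots> \<le> 2 powr p * (?n (u v - u w) + ?n (u w))"
        by (rule powr_add_le) (use p in auto)
      finally have "?n (u v) / 2 powr p \<le> ?n (u v - u w) + ?n (u w)"
        by (simp add: field_simps)
      then show "(case e of (v, w) \<Rightarrow> ?n (u v) / 2 powr p - ?n (u w)) \<le> f e"
        using e p by (simp add: f_def)
    qed
    moreover have "(\<Sum>(v, w)\<in>G. ?n (u v) / 2 powr p) \<ge> (real d - real dmax) / 2 powr p * S"
    proof -
      have "(\<Sum>(v, w)\<in>G. ?n (u v) / 2 powr p) = (\<Sum>v\<in>A. \<Sum>w\<in>GC v. ?n (u v) / 2 powr p)"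
        unfolding G_def using A(1) finGC by (subst sum.Sigma) auto
      also have "\<dots> = (\<Sum>v\<in>A. real (card (GC v)) * (?n (u v) / 2 powr p))" by simp
      also have "\<dots> \<ge> (\<Sum>v\<in>A. (real d - real dmax) * (?n (u v) / 2 powr p))"
        using cardGC by (intro sum_mono mult_right_mono) auto
      finally show ?thesis by (simp add: S_def sum_distrib_left sum_divide_distrib)
    qed
    moreover have "(\<Sum>(v, w)\<in>G. ?n (u w)) \<le> S"
    proof -
      have "inj_on snd G"
        by (auto simp: inj_on_def G_def GC_def child_pair_def)
      then have "(\<Sum>(v, w)\<in>G. ?n (u w)) = (\<Sum>w\<in>snd ` G. ?n (u w))"
        by (subst sum.reindex) (auto simp: case_prod_beta)
      also have "\<dots> = (\<Sum>w\<in>snd ` G \<inter> A. ?n (u w))"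
        using z G p by (intro sum.mono_neutral_right) auto
      also have "\<dots> \<le> S"
        unfolding S_def using A(1) by (intro sum_mono2) auto
      finally show ?thesis .
    qed
    ultimately show ?thesis
      by (simp add: sum_subtractf case_prod_beta algebra_simps)
  qed
  have "H_sos d p A (\<lambda>x. \<omega> x + u x) - H_sos d p A \<omega> = sum f E"
    unfolding H_sos_alt E_def[symmetric] f_def by (simp add: sum_subtractf case_prod_beta)
  also have "\<dots> = sum f good + sum f bad"
  proof (subst sum.union_disjoint[symmetric])
    show "finite good" "finite bad"
      by (auto simp: good_def bad_def intro: finite_subset[OF _ finE])
    show "good \<inter> bad = {}" by (auto simp: good_def bad_def)
    show "sum f E = sum f (good \<union> bad)"
      by (rule arg_cong[where f = "sum f"]) (auto simp: good_def bad_def)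
  qed
  also have "\<dots> \<ge> ((real d - real dmax) / 2 powr p - 1 - real dmax * real M powr p) * S"
    using good_sum bad_sum by (simp add: algebra_simps)
  finally have *: "((real d - real dmax) / 2 powr p - 1 - real dmax * real M powr p) * S
      \<le> H_sos d p A (\<lambda>x. \<omega> x + u x) - H_sos d p A \<omega>" .
  \<comment> \<open>Of the 2 in the condition on \<open>d\<close>, one unit covers the payments made
    by children and the other is the coefficient of \<open>S\<close> that survives.\<close>
  have "(2 + real dmax * real M powr p) \<le> (real d - real dmax) / 2 powr p"
    using d by (simp add: field_simps)
  then have "1 * S \<le> ((real d - real dmax) / 2 powr p - 1 - real dmax * real M powr p) * S"
    by (intro mult_right_mono) (auto simp: S_def sum_nonneg)
  with * show ?thesis by (simp add: S_def)
qed

subsection \<open>Normalisation and limits of discrete laws\<close>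

text \<open>Change of variables for a discrete law. Its purpose is the case where \<open>T\<close>
  overwrites the spins in a finite set, so that all weights change by one common Boltzmann
  factor.\<close>

lemma measure_pmf_bij_scale:
  assumes "bij_betw T E E'" "\<And>x. x \<in> E \<Longrightarrow> pmf \<nu> (T x) = c * pmf \<nu> x"
  shows "measure (measure_pmf \<nu>) E' = c * measure (measure_pmf \<nu>) E"
proof -
  have "measure (measure_pmf \<nu>) E' = infsetsum (\<lambda>x. pmf \<nu> (T x)) E"
    by (simp add: measure_pmf_conv_infsetsum infsetsum_reindex_bij_betw[OF assms(1)])
  also have "\<dots> = infsetsum (\<lambda>x. c * pmf \<nu> x) E"
    by (intro infsetsum_cong assms) auto
  finally show ?thesis
    by (simp add: measure_pmf_conv_infsetsum infsetsum_cmult_right pmf_abs_summable)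
qed

lemma ex_normalized_pmf:
  fixes f :: "'a \<Rightarrow> real"
  assumes "\<And>x. f x \<ge> 0" "f x0 > 0" "(\<integral>\<^sup>+x. ennreal (f x) \<partial>count_space UNIV) < \<infinity>"
  shows "\<exists>\<nu> Z. Z > 0 \<and> (\<forall>x. pmf \<nu> x = f x / Z)"
proof -
  obtain Z where Z: "(\<integral>\<^sup>+x. ennreal (f x) \<partial>count_space UNIV) = ennreal Z" "Z \<ge> 0"
    using assms(3) by (cases "\<integral>\<^sup>+x. ennreal (f x) \<partial>count_space UNIV") auto
  have "ennreal (f x0) \<le> ennreal Z"
    unfolding Z(1)[symmetric] by (rule nn_integral_ge_point) simp
  with assms(2) Z(2) have pos: "Z > 0" by simp
  have "(\<integral>\<^sup>+x. ennreal (f x / Z) \<partial>count_space UNIV) = ennreal Z / ennreal Z"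
    using pos assms(1) by (simp add: divide_ennreal[symmetric] nn_integral_divide Z(1))
  also have "\<dots> = 1" using pos by (simp add: divide_ennreal)
  finally have "pmf (embed_pmf (\<lambda>x. f x / Z)) x = f x / Z" for x
    using pos assms(1) by (intro pmf_embed_pmf) auto
  with pos show ?thesis by blast
qed

lemma nn_integral_pmf_bound_finite:
  assumes "\<And>x. f x \<le> C * pmf q x" "\<And>x. f x \<ge> 0" "C \<ge> 0"
  shows "(\<integral>\<^sup>+x. ennreal (f x) \<partial>count_space UNIV) < \<infinity>"
proof -
  have "(\<integral>\<^sup>+x. ennreal (f x) \<partial>count_space UNIV) \<le> (\<integral>\<^sup>+x. ennreal C * ennreal (pmf q x) \<partial>count_space UNIV)"
    using assms by (intro nn_integral_mono) (simp add: ennreal_mult[symmetric] ennreal_leI)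
  also have "\<dots> = ennreal C * (\<integral>\<^sup>+x. ennreal (pmf q x) \<partial>count_space UNIV)"
    by (rule nn_integral_cmult) simp
  also have "\<dots> = ennreal C" by (simp add: nn_integral_pmf_eq_1)
  finally show ?thesis by (simp add: le_less_trans)
qed

text \<open>Pointwise limits of probability weights can lose mass at infinity. The common summable
  bound \<open>C * pmf r x\<close> excludes this: dominated convergence gives the limit total mass 1
  and convergence on every set, not only on points.\<close>

lemma pmf_dominated_limit:
  fixes q :: "nat \<Rightarrow> 'a pmf"
  assumes lim: "\<And>x. (\<lambda>n. pmf (q n) x) \<longlonglongrightarrow> f x" and dom: "\<And>n x. pmf (q n) x \<le> C * pmf r x"
  shows "\<exists>Q. (\<forall>x. pmf Q x = f x) \<and> (\<forall>B. (\<lambda>n. measure (measure_pmf (q n)) B) \<longlonglongrightarrow> measure (measure_pmf Q) B)"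
proof -
  have pos: "f x \<ge> 0" for x by (rule LIMSEQ_le_const[OF lim]) auto
  have int: "integrable (count_space B) (\<lambda>x. C * pmf r x)" for B
    using pmf_abs_summable[of r B] by (simp add: abs_summable_on_def)
  have *: "(\<lambda>n. measure (measure_pmf (q n)) B) \<longlonglongrightarrow> (\<integral>x. f x \<partial>count_space B)" for B
    unfolding measure_pmf_conv_infsetsum infsetsum_def
    by (rule integral_dominated_convergence[OF _ _ int]) (auto simp: lim dom)
  have "f x \<le> C * pmf r x" for x
    by (rule LIMSEQ_le_const2[OF lim]) (auto simp: dom)
  then have intf: "integrable (count_space UNIV) f"
    by (intro Bochner_Integration.integrable_bound[OF int])
       (auto simp: pos intro!: AE_I2 order_trans[OF _ abs_ge_self])
  have "(\<integral>x. f x \<partial>count_space UNIV) = 1"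
    using *[of UNIV] LIMSEQ_unique[OF _ tendsto_const] by (simp add: measure_pmf.prob_space[simplified])
  then have "(\<integral>\<^sup>+x. ennreal (f x) \<partial>count_space UNIV) = 1"
    using intf pos by (subst nn_integral_eq_integral) auto
  then have Q: "pmf (embed_pmf f) x = f x" for x
    using pos by (intro pmf_embed_pmf) auto
  have "measure (measure_pmf (embed_pmf f)) B = (\<integral>x. f x \<partial>count_space B)" for B
    unfolding measure_pmf_conv_infsetsum infsetsum_def
    by (rule Bochner_Integration.integral_cong[OF refl Q])
  with Q * show ?thesis by metis
qed

section \<open>One-site sums at low temperature\<close>

lemma summable_exp_powr:
  fixes p :: real
  assumes "p > 0"
  shows "summable (\<lambda>n. exp (- (real (Suc n) powr p)))"
proof (rule summable_comparison_test_bigo)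
  show "summable (\<lambda>n. norm (1 / real n ^ 2))"
    using inverse_power_summable[of 2, where 'a = real] by (simp add: field_simps)
  show "(\<lambda>n. exp (- (real (Suc n) powr p))) \<in> O(\<lambda>n. 1 / real n ^ 2)"
    using assms by real_asymp
qed

lemma nn_integral_exp_powr_int_finite:
  fixes p :: real
  assumes "p > 0"
  shows "(\<integral>\<^sup>+k. ennreal (exp (- (\<bar>real_of_int k\<bar> powr p))) \<partial>count_space (- {0::int})) < \<infinity>"
proof -
  let ?f = "\<lambda>k::int. ennreal (exp (- (\<bar>real_of_int k\<bar> powr p)))"
  have b1: "bij_betw (\<lambda>n. int (Suc n)) UNIV {1..}"
    by (rule bij_betwI[where g = "\<lambda>k. nat (k - 1)"]) auto
  have b2: "bij_betw (\<lambda>n. - int (Suc n)) UNIV {..-1}"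
    by (rule bij_betwI[where g = "\<lambda>k. nat (- k - 1)"]) auto
  have fin: "(\<integral>\<^sup>+n. ennreal (exp (- (real (Suc n) powr p))) \<partial>count_space UNIV) < \<infinity>"
    using summable_exp_powr[OF assms]
    by (simp add: nn_integral_count_space_nat suminf_ennreal2 less_top[symmetric] del: of_nat_Suc)
  have i1: "(\<integral>\<^sup>+k. ?f k \<partial>count_space {1..}) < \<infinity>"
    using nn_integral_bij_count_space[OF b1, of ?f] fin by (simp add: add.commute)
  have i2: "(\<integral>\<^sup>+k. ?f k \<partial>count_space {..-1}) < \<infinity>"
    using nn_integral_bij_count_space[OF b2, of ?f] fin
    by (simp add: add.commute abs_minus_commute[of "-1"] abs_if)
  have "- {0::int} = {1..} \<union> {..-1}" by auto
  moreover have "(\<integral>\<^sup>+k. ?f k \<partial>count_space ({1..} \<union> {..-1}))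
      = (\<integral>\<^sup>+k. ?f k \<partial>count_space {1..}) + (\<integral>\<^sup>+k. ?f k \<partial>count_space {..-1})"
  proof -
    have "(\<integral>\<^sup>+k. ?f k \<partial>count_space ({1..} \<union> {..-1}))
      = (\<integral>\<^sup>+k. ?f k * indicator {1..} k + ?f k * indicator {..-1} k \<partial>count_space UNIV)"
      by (subst nn_integral_count_space_indicator)
         (auto intro!: nn_integral_cong simp: indicator_def)
    also have "\<dots> = (\<integral>\<^sup>+k. ?f k * indicator {1..} k \<partial>count_space UNIV) + (\<integral>\<^sup>+k. ?f k * indicator {..-1} k \<partial>count_space UNIV)"
      by (rule nn_integral_add) auto
    finally show ?thesis by (simp add: nn_integral_count_space_indicator)
  qed
  ultimately show ?thesis using i1 i2 by simp
qed

text \<open>For \<open>k \<noteq> 0\<close> one has |k|^p \<ge> 1, hence \<beta> |k|^p \<ge>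
  (\<beta> - 1) + |k|^p when \<beta> \<ge> 1. The sum is thus at most exp(-(\<beta> - 1)) times its
  value \<open>K\<close> at inverse temperature 1.\<close>

lemma exp_powr_int_tail_small:
  fixes p \<epsilon> :: real
  assumes "p > 0" "\<epsilon> > 0"
  shows "\<exists>\<beta>0>0. \<forall>\<beta>\<ge>\<beta>0.
    (\<integral>\<^sup>+k. ennreal (exp (- \<beta> * \<bar>real_of_int k\<bar> powr p)) \<partial>count_space (- {0::int})) \<le> ennreal \<epsilon>"
proof -
  obtain K where K: "(\<integral>\<^sup>+k. ennreal (exp (- (\<bar>real_of_int k\<bar> powr p))) \<partial>count_space (- {0::int})) = ennreal K" "K \<ge> 0"
    using nn_integral_exp_powr_int_finite[OF assms(1)]
    by (cases "\<integral>\<^sup>+k. ennreal (exp (- (\<bar>real_of_int k\<bar> powr p))) \<partial>count_space (- {0::int})") auto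
  have "((\<lambda>\<beta>. exp (- (\<beta> - 1)) * K) \<longlongrightarrow> 0) at_top"
    by real_asymp
  then have "eventually (\<lambda>\<beta>. exp (- (\<beta> - 1)) * K < \<epsilon>) at_top"
    using assms(2) by (rule order_tendstoD)
  then obtain \<beta>1 where \<beta>1: "\<And>\<beta>. \<beta> \<ge> \<beta>1 \<Longrightarrow> exp (- (\<beta> - 1)) * K < \<epsilon>"
    by (auto simp: eventually_at_top_linorder)
  have "(\<integral>\<^sup>+k. ennreal (exp (- \<beta> * \<bar>real_of_int k\<bar> powr p)) \<partial>count_space (- {0::int})) \<le> ennreal \<epsilon>"
    if \<beta>: "\<beta> \<ge> max 1 \<beta>1" for \<beta>
  proof -
    have "(\<integral>\<^sup>+k. ennreal (exp (- \<beta> * \<bar>real_of_int k\<bar> powr p)) \<partial>count_space (- {0::int}))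
      \<le> (\<integral>\<^sup>+k. ennreal (exp (- (\<beta> - 1))) * ennreal (exp (- (\<bar>real_of_int k\<bar> powr p))) \<partial>count_space (- {0::int}))"
    proof (rule nn_integral_mono)
      fix k assume "k \<in> space (count_space (- {0::int}))"
      then have "1 \<le> \<bar>real_of_int k\<bar> powr p" by (intro one_le_int_powr assms) auto
      then have "(\<beta> - 1) * 1 \<le> (\<beta> - 1) * \<bar>real_of_int k\<bar> powr p"
        using \<beta> by (intro mult_left_mono) auto
      then have "exp (- \<beta> * \<bar>real_of_int k\<bar> powr p) \<le> exp (- (\<beta> - 1) - \<bar>real_of_int k\<bar> powr p)"
        by (simp add: algebra_simps)
      then show "ennreal (exp (- \<beta> * \<bar>real_of_int k\<bar> powr p))
        \<le> ennreal (exp (- (\<beta> - 1))) * ennreal (exp (- (\<bar>real_of_int k\<bar> powr p)))"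
        by (simp add: ennreal_mult[symmetric] exp_add[symmetric] ennreal_leI)
    qed
    also have "\<dots> = ennreal (exp (- (\<beta> - 1)) * K)"
      by (subst nn_integral_cmult) (simp_all add: K ennreal_mult)
    also have "\<dots> \<le> ennreal \<epsilon>" using \<beta>1[of \<beta>] \<beta> by (intro ennreal_leI) simp
    finally show ?thesis .
  qed
  then show ?thesis by (intro exI[of _ "max 1 \<beta>1"]) auto
qed

subsection \<open>Finite-volume measures and the Peierls bound\<close>

text \<open>\<open>\<theta>\<close> bounds the total one-site weight of all non-zero deviations, so
  temperature enters the Peierls argument mainly through it. The condition
  \<open>\<theta>_small\<close> says that this weight outweighs the factor
  \<open>2 ^ (d + 2)\<close> charged for the neighbours of a newly found non-zero site.\<close>

locale low_temperature_sos =
  fixes d dmax M :: nat and p \<beta> \<theta> :: real and \<omega> :: "nat list \<Rightarrow> int"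
  assumes p: "p > 0" and \<beta>: "\<beta> > 0" and \<omega>: "\<omega> \<in> G0 dmax d M"
    and d: "real d \<ge> real dmax + 2 powr p * (2 + real dmax * real M powr p)"
    and \<theta>: "\<theta> > 0" "(\<integral>\<^sup>+k. ennreal (exp (- \<beta> * \<bar>real_of_int k\<bar> powr p)) \<partial>count_space (- {0::int})) \<le> ennreal \<theta>"
    and \<theta>_small: "2 ^ (d + 2) * \<theta> \<le> 1"
begin

abbreviation ball :: "nat \<Rightarrow> nat list set" where "ball n \<equiv> tree_ball d n"
abbreviation pnorm :: "int \<Rightarrow> real" where "pnorm k \<equiv> \<bar>real_of_int k\<bar> powr p"
abbreviation energy :: "nat list set \<Rightarrow> (nat list \<Rightarrow> int) \<Rightarrow> real" where
  "energy A u \<equiv> H_sos d p A (\<lambda>x. \<omega> x + u x)"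

lemma ex_single_spin_pmf: "\<exists>q Z. Z > 0 \<and> (\<forall>k. pmf q k = exp (- \<beta> * pnorm k) / Z)"
proof (rule ex_normalized_pmf)
  have "(\<integral>\<^sup>+k. ennreal (exp (- \<beta> * pnorm k)) \<partial>count_space UNIV)
    = (\<integral>\<^sup>+k. ennreal (exp (- \<beta> * pnorm k)) * indicator {0} k + ennreal (exp (- \<beta> * pnorm k)) * indicator (- {0}) k \<partial>count_space UNIV)"
    by (auto intro!: nn_integral_cong simp: indicator_def)
  also have "\<dots> = (\<integral>\<^sup>+k. ennreal (exp (- \<beta> * pnorm k)) * indicator {0} k \<partial>count_space UNIV)
     + (\<integral>\<^sup>+k. ennreal (exp (- \<beta> * pnorm k)) * indicator (- {0}) k \<partial>count_space UNIV)"
    by (rule nn_integral_add) auto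
  also have "\<dots> < \<infinity>"
    using \<theta> by (auto simp: nn_integral_count_space_indicator[symmetric] nn_integral_count_space_finite less_top[symmetric] top_unique)
  finally show "(\<integral>\<^sup>+k. ennreal (exp (- \<beta> * pnorm k)) \<partial>count_space UNIV) < \<infinity>" .
qed auto

text \<open>The law of a spin that feels only the cost |k|^p of its own deviation. Products of it
  are the dominating laws for the finite-volume weights and for all finite marginals.\<close>

definition spin_pmf :: "int pmf" where
  "spin_pmf = (SOME q. \<exists>Z>0. \<forall>k. pmf q k = exp (- \<beta> * pnorm k) / Z)"

definition spin_Z :: real where
  "spin_Z = (SOME Z. Z > 0 \<and> (\<forall>k. pmf spin_pmf k = exp (- \<beta> * pnorm k) / Z))"

lemma spin_Z_pos: "spin_Z > 0" and pmf_spin_pmf: "pmf spin_pmf k = exp (- \<beta> * pnorm k) / spin_Z"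
proof -
  have "\<exists>Z>0. \<forall>k. pmf spin_pmf k = exp (- \<beta> * pnorm k) / Z"
    unfolding spin_pmf_def by (rule someI_ex) (use ex_single_spin_pmf in blast)
  then have "spin_Z > 0 \<and> (\<forall>k. pmf spin_pmf k = exp (- \<beta> * pnorm k) / spin_Z)"
    unfolding spin_Z_def by (rule someI_ex)
  then show "spin_Z > 0" "pmf spin_pmf k = exp (- \<beta> * pnorm k) / spin_Z" by auto
qed

lemma exp_sum_eq_Pi_pmf:
  assumes "finite A" "\<And>x. x \<notin> A \<Longrightarrow> u x = 0"
  shows "exp (- \<beta> * (\<Sum>x\<in>A. pnorm (u x))) = spin_Z ^ card A * pmf (Pi_pmf A 0 (\<lambda>_. spin_pmf)) u"
proof -
  have "pmf (Pi_pmf A 0 (\<lambda>_. spin_pmf)) u = (\<Prod>x\<in>A. exp (- \<beta> * pnorm (u x)) / spin_Z)"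
    using assms by (subst pmf_Pi') (auto simp: pmf_spin_pmf)
  also have "\<dots> = exp (- \<beta> * (\<Sum>x\<in>A. pnorm (u x))) / spin_Z ^ card A"
    by (simp add: prod_dividef exp_sum[OF assms(1), symmetric] sum_distrib_left)
  finally show ?thesis using spin_Z_pos by simp
qed

text \<open>Restriction to the sites where \<open>u\<close> is non-zero changes neither side: zero
  sites have no cost, and by locality the energy difference only sees the support.\<close>

lemma excess_energy_support:
  assumes "finite A" "A \<subseteq> cayley_V d" "\<And>x. x \<notin> A \<Longrightarrow> u x = 0"
  shows "(\<Sum>x\<in>A. pnorm (u x)) \<le> energy A u - H_sos d p A \<omega>"
proof -
  let ?S = "{x \<in> A. u x \<noteq> 0}"
  have "(\<Sum>x\<in>A. pnorm (u x)) = (\<Sum>x\<in>?S. pnorm (u x))"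
    using assms p by (intro sum.mono_neutral_right) auto
  also have "\<dots> \<le> energy ?S u - H_sos d p ?S \<omega>"
    using assms by (intro excess_energy[OF p \<omega> _ _ _ _ d]) auto
  also have "\<dots> = energy A u - H_sos d p A \<omega>"
    using assms by (intro H_sos_diff_local[symmetric]) auto
  finally show ?thesis .
qed

text \<open>The variable is the deviation \<open>u\<close> from \<open>\<omega>\<close>, so the
  boundary condition \<open>\<omega>\<close> becomes \<open>u = 0\<close> off the ball. Subtracting
  the energy of \<open>\<omega>\<close> makes the weight at most the corresponding product of
  one-site weights, which is what makes it normalisable.\<close>

definition weight :: "nat \<Rightarrow> (nat list \<Rightarrow> int) \<Rightarrow> real" where
  "weight n u = (if \<forall>x. x \<notin> ball n \<longrightarrow> u x = 0
     then exp (- \<beta> * (energy (ball n) u - H_sos d p (ball n) \<omega>)) else 0)"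

lemma ex_finite_volume_pmf: "\<exists>\<nu> Z. Z > 0 \<and> (\<forall>u. pmf \<nu> u = weight n u / Z)"
proof (rule ex_normalized_pmf)
  show "weight n u \<ge> 0" for u by (simp add: weight_def)
  show "weight n (\<lambda>_. 0) > 0" by (simp add: weight_def)
  have "weight n u \<le> spin_Z ^ card (ball n) * pmf (Pi_pmf (ball n) 0 (\<lambda>_. spin_pmf)) u" for u
  proof (cases "\<forall>x. x \<notin> ball n \<longrightarrow> u x = 0")
    case True
    then have "weight n u \<le> exp (- \<beta> * (\<Sum>x\<in>ball n. pnorm (u x)))"
      using \<beta> excess_energy_support[OF finite_tree_ball tree_ball_subset, of n u]
      by (simp add: weight_def)
    also have "\<dots> = spin_Z ^ card (ball n) * pmf (Pi_pmf (ball n) 0 (\<lambda>_. spin_pmf)) u"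
      using True by (intro exp_sum_eq_Pi_pmf) auto
    finally show ?thesis .
  next
    case False
    then have "weight n u = 0" unfolding weight_def by (rule if_not_P)
    then show ?thesis using spin_Z_pos by simp
  qed
  then show "(\<integral>\<^sup>+u. ennreal (weight n u) \<partial>count_space UNIV) < \<infinity>"
    by (rule nn_integral_pmf_bound_finite) (use spin_Z_pos in \<open>auto simp: weight_def\<close>)
qed

definition finite_volume :: "nat \<Rightarrow> (nat list \<Rightarrow> int) pmf" where
  "finite_volume n = (SOME \<nu>. \<exists>Z>0. \<forall>u. pmf \<nu> u = weight n u / Z)"

abbreviation prob_n :: "nat \<Rightarrow> (nat list \<Rightarrow> int) set \<Rightarrow> real" where
  "prob_n n \<equiv> measure (measure_pmf (finite_volume n))"

lemma finite_volume_weight: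
  obtains Z where "Z > 0" "\<And>u. pmf (finite_volume n) u = weight n u / Z"
proof -
  have "\<exists>Z>0. \<forall>u. pmf (finite_volume n) u = weight n u / Z"
    unfolding finite_volume_def by (rule someI_ex) (use ex_finite_volume_pmf in blast)
  with that show thesis by blast
qed

lemma finite_volume_support: "u \<in> set_pmf (finite_volume n) \<Longrightarrow> x \<notin> ball n \<Longrightarrow> u x = 0"
  by (rule finite_volume_weight[of n]) (auto simp: set_pmf_eq weight_def split: if_splits)

text \<open>Overwriting the values on \<open>A\<close> is a bijection between the two events. Every
  neighbour of \<open>A\<close> is either prescribed by \<open>D\<close> or frozen at zero outside
  the ball, so all weights are multiplied by the same factor and the partition function never
  appears.\<close>

lemma finite_volume_ratio:
  assumes A: "A \<subseteq> ball n" "A \<subseteq> D" and eq: "\<And>x. x \<notin> A \<Longrightarrow> \<zeta> x = \<zeta>' x"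
    and nb: "\<And>x y. x \<in> A \<Longrightarrow> tree_adj d x y \<Longrightarrow> y \<in> D \<or> y \<notin> ball n \<and> \<zeta> y = 0"
  shows "prob_n n {u. \<forall>x\<in>D. u x = \<zeta> x} * exp (- \<beta> * energy A \<zeta>')
    = prob_n n {u. \<forall>x\<in>D. u x = \<zeta>' x} * exp (- \<beta> * energy A \<zeta>)"
proof -
  define T where "T \<xi> u = (\<lambda>x. if x \<in> A then \<xi> x else u x)" for \<xi> u :: "nat list \<Rightarrow> int"
  define c where "c = exp (- \<beta> * (energy A \<zeta>' - energy A \<zeta>))"
  have "prob_n n {u. \<forall>x\<in>D. u x = \<zeta>' x} = c * prob_n n {u. \<forall>x\<in>D. u x = \<zeta> x}"
  proof (rule measure_pmf_bij_scale)
    show "bij_betw (T \<zeta>') {u. \<forall>x\<in>D. u x = \<zeta> x} {u. \<forall>x\<in>D. u x = \<zeta>' x}"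
      by (rule bij_betwI[where g = "T \<zeta>"]) (use A eq in \<open>auto simp: T_def fun_eq_iff\<close>)
    fix u assume u: "u \<in> {u. \<forall>x\<in>D. u x = \<zeta> x}"
    have "weight n (T \<zeta>' u) = c * weight n u"
    proof (cases "\<forall>x. x \<notin> ball n \<longrightarrow> u x = 0")
      case True
      have "energy (ball n) (T \<zeta>' u) - energy (ball n) u = energy A (T \<zeta>' u) - energy A u"
        using A by (intro H_sos_diff_local) (auto simp: T_def)
      also have "energy A (T \<zeta>' u) = energy A \<zeta>'"
      proof (rule H_sos_cong)
        show "\<omega> y + T \<zeta>' u y = \<omega> y + \<zeta>' y" if "x \<in> A" "tree_adj d x y" for x y
          using nb[OF that] True u eq[of y] by (auto simp: T_def)
      qed (auto simp: T_def)
      also have "energy A u = energy A \<zeta>"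
      proof (rule H_sos_cong)
        show "\<omega> y + u y = \<omega> y + \<zeta> y" if "x \<in> A" "tree_adj d x y" for x y
          using nb[OF that] True u by auto
      qed (use u A in auto)
      finally have "energy (ball n) (T \<zeta>' u) = energy (ball n) u + (energy A \<zeta>' - energy A \<zeta>)"
        by linarith
      moreover have "\<forall>x. x \<notin> ball n \<longrightarrow> T \<zeta>' u x = 0" using True A by (auto simp: T_def)
      ultimately show ?thesis
        using True by (simp add: weight_def c_def exp_add[symmetric], simp add: algebra_simps)
    next
      case False
      then have "\<not> (\<forall>x. x \<notin> ball n \<longrightarrow> T \<zeta>' u x = 0)" using A by (auto simp: T_def)
      then have "weight n (T \<zeta>' u) = 0" unfolding weight_def by (rule if_not_P)
      moreover have "weight n u = 0" unfolding weight_def by (rule if_not_P[OF False])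
      ultimately show ?thesis by simp
    qed
    then show "pmf (finite_volume n) (T \<zeta>' u) = c * pmf (finite_volume n) u"
      by (rule_tac finite_volume_weight[of n]) simp
  qed
  moreover have "c * exp (- \<beta> * energy A \<zeta>) = exp (- \<beta> * energy A \<zeta>')"
    by (simp add: c_def exp_add[symmetric] algebra_simps)
  ultimately show ?thesis by (simp add: mult_ac)
qed

lemma prob_n_sum_nonzero_le:
  assumes "\<And>k. k \<noteq> 0 \<Longrightarrow> prob_n n {u \<in> E. u y = k} \<le> c * exp (- \<beta> * pnorm k)" "c \<ge> 0"
  shows "prob_n n {u \<in> E. u y \<noteq> 0} \<le> c * \<theta>"
proof -
  let ?P = "measure_pmf (finite_volume n)"
  have "{u \<in> E. u y \<noteq> 0} = (\<Union>k\<in>-{0}. {u \<in> E. u y = k})" by auto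
  then have "emeasure ?P {u \<in> E. u y \<noteq> 0} = (\<integral>\<^sup>+k. emeasure ?P {u \<in> E. u y = k} \<partial>count_space (-{0}))"
    by (simp, subst emeasure_UN_countable) (auto simp: disjoint_family_on_def)
  also have "\<dots> \<le> (\<integral>\<^sup>+k. ennreal c * ennreal (exp (- \<beta> * pnorm k)) \<partial>count_space (-{0}))"
    using assms by (intro nn_integral_mono)
      (auto simp: measure_pmf.emeasure_eq_measure ennreal_mult[symmetric] intro!: ennreal_leI)
  also have "\<dots> = ennreal c * (\<integral>\<^sup>+k. ennreal (exp (- \<beta> * pnorm k)) \<partial>count_space (-{0}))"
    by (rule nn_integral_cmult) simp
  also have "\<dots> \<le> ennreal c * ennreal \<theta>"
    using \<theta> by (intro mult_left_mono) auto
  finally show ?thesis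
    using assms(2) \<theta>(1) by (simp add: measure_pmf.emeasure_eq_measure ennreal_mult[symmetric])
qed

definition unexplored :: "nat \<Rightarrow> nat list set \<Rightarrow> nat list set \<Rightarrow> nat list set" where
  "unexplored n A Z = {y \<in> ball n - (A \<union> Z). \<exists>x\<in>A. tree_adj d x y}"

text \<open>The cluster of non-zero vertices containing \<open>A\<close> is explored one neighbour at a time.
  Once its outer boundary is known to vanish, the cluster can be erased at the price of its
  excess energy. A newly discovered non-zero vertex has at most \<open>d + 2\<close> unexplored
  neighbours (a crude bound), each of which is charged a factor \<open>2\<close>.\<close>

lemma peierls_exploration:
  assumes "A \<subseteq> ball n" "\<And>x. x \<in> A \<Longrightarrow> \<zeta> x \<noteq> 0" "A \<inter> Z = {}"
  shows "prob_n n {u. (\<forall>x\<in>A. u x = \<zeta> x) \<and> (\<forall>x\<in>Z. u x = 0)}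
    \<le> exp (- \<beta> * (\<Sum>x\<in>A. pnorm (\<zeta> x))) * 2 ^ card (unexplored n A Z)"
  using assms
\<comment> \<open>The induction is on the number of sites of the ball not yet examined:
  \<open>A\<close> holds the sites found non-zero, \<open>Z\<close> those found to vanish.\<close>
proof (induction "card (ball n - (A \<union> Z))" arbitrary: A Z \<zeta> rule: less_induct)
  case less
  note A = less.prems
  have finA: "finite A" by (rule finite_subset[OF A(1)]) simp
  show ?case
  proof (cases "unexplored n A Z = {}")
    case True
    \<comment> \<open>Every neighbour of \<open>A\<close> in the ball now belongs to
      \<open>A\<close> or \<open>Z\<close>, so the values on \<open>A\<close> may be compared with
      zero; the probability of the erased event is then bounded by 1.\<close>
    let ?z = "\<lambda>x. if x \<in> A then \<zeta> x else 0"
    have *: "prob_n n {u. \<forall>x\<in>A \<union> Z. u x = ?z x} * exp (- \<beta> * energy A (\<lambda>_. 0))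
      = prob_n n {u. \<forall>x\<in>A \<union> Z. u x = 0} * exp (- \<beta> * energy A ?z)"
      by (rule finite_volume_ratio) (use A(1) True in \<open>auto simp: unexplored_def\<close>)
    have "{u. \<forall>x\<in>A \<union> Z. u x = ?z x} = {u. (\<forall>x\<in>A. u x = \<zeta> x) \<and> (\<forall>x\<in>Z. u x = 0)}"
      using A(3) by auto
    with * have "prob_n n {u. (\<forall>x\<in>A. u x = \<zeta> x) \<and> (\<forall>x\<in>Z. u x = 0)} * exp (- \<beta> * H_sos d p A \<omega>)
      \<le> 1 * exp (- \<beta> * energy A ?z)" by (simp add: mult_right_mono)
    then have "prob_n n {u. (\<forall>x\<in>A. u x = \<zeta> x) \<and> (\<forall>x\<in>Z. u x = 0)}
      \<le> exp (- \<beta> * energy A ?z) / exp (- \<beta> * H_sos d p A \<omega>)" by (simp add: field_simps)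
    also have "\<dots> = exp (- \<beta> * (energy A ?z - H_sos d p A \<omega>))"
      by (simp add: exp_diff[symmetric] algebra_simps)
    also have "\<dots> \<le> exp (- \<beta> * (\<Sum>x\<in>A. pnorm (?z x)))"
      using \<beta> A(1) excess_energy_support[of A ?z] finA tree_ball_subset[of d n] by auto
    finally show ?thesis using True by simp
  next
    case False
    then obtain y where y: "y \<in> unexplored n A Z" by auto
    then have yb: "y \<in> ball n" "y \<notin> A" "y \<notin> Z" by (auto simp: unexplored_def)
    define E where "E = {u. (\<forall>x\<in>A. u x = \<zeta> x) \<and> (\<forall>x\<in>Z. u x = 0)}"
    define w where "w = exp (- \<beta> * (\<Sum>x\<in>A. pnorm (\<zeta> x)))"
    define c where "c = card (unexplored n A Z)"
    have fin: "finite (unexplored n A' Z')" for A' Z' by (auto simp: unexplored_def)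
    have c: "c \<ge> 1" using fin[of A Z] y by (auto simp: c_def Suc_le_eq card_gt_0_iff)
    have smaller: "card (ball n - (A \<union> insert y Z)) < card (ball n - (A \<union> Z))"
      "card (ball n - (insert y A \<union> Z)) < card (ball n - (A \<union> Z))"
      by (intro psubset_card_mono; use yb in force)+
    have U1: "card (unexplored n A (insert y Z)) = c - 1"
    proof -
      have "unexplored n A (insert y Z) = unexplored n A Z - {y}" by (auto simp: unexplored_def)
      then show ?thesis using y fin by (simp add: c_def)
    qed
    have U2: "card (unexplored n (insert y A) Z) \<le> (c - 1) + (d + 2)"
    proof -
      have "unexplored n (insert y A) Z \<subseteq> (unexplored n A Z - {y}) \<union> {x. tree_adj d y x}"
        by (auto simp: unexplored_def)
      then have "card (unexplored n (insert y A) Z) \<le> card ((unexplored n A Z - {y}) \<union> {x. tree_adj d y x})"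
        using fin by (intro card_mono) auto
      also have "\<dots> \<le> card (unexplored n A Z - {y}) + card {x. tree_adj d y x}"
        by (rule card_Un_le)
      finally show ?thesis using y fin card_tree_neighbours[of d y] by (simp add: c_def)
    qed
    have "prob_n n {u \<in> E. u y = 0} \<le> w * 2 ^ (c - 1)"
    proof -
      have "{u \<in> E. u y = 0} = {u. (\<forall>x\<in>A. u x = \<zeta> x) \<and> (\<forall>x\<in>insert y Z. u x = 0)}"
        by (auto simp: E_def)
      then show ?thesis using less.hyps[OF smaller(1) A(1)] A yb U1 by (simp add: w_def)
    qed
    moreover have "prob_n n {u \<in> E. u y \<noteq> 0} \<le> w * 2 ^ (c - 1 + (d + 2)) * \<theta>"
    proof (rule prob_n_sum_nonzero_le)
      fix k :: int assume "k \<noteq> 0"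
      have "{u \<in> E. u y = k} = {u. (\<forall>x\<in>insert y A. u x = (\<zeta>(y := k)) x) \<and> (\<forall>x\<in>Z. u x = 0)}"
        using yb by (auto simp: E_def)
      moreover have "insert y A \<subseteq> ball n" "\<And>x. x \<in> insert y A \<Longrightarrow> (\<zeta>(y := k)) x \<noteq> 0"
        "insert y A \<inter> Z = {}" using A yb \<open>k \<noteq> 0\<close> by auto
      note less.hyps[OF smaller(2), of "\<zeta>(y := k)", OF this]
      ultimately have "prob_n n {u \<in> E. u y = k} \<le> exp (- \<beta> * (\<Sum>x\<in>insert y A. pnorm ((\<zeta>(y := k)) x)))
          * 2 ^ card (unexplored n (insert y A) Z)" by simp
      also have "(\<Sum>x\<in>insert y A. pnorm ((\<zeta>(y := k)) x)) = pnorm k + (\<Sum>x\<in>A. pnorm (\<zeta> x))"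
        using yb finA by (simp, intro sum.cong) auto
      also have "exp (- \<beta> * (pnorm k + (\<Sum>x\<in>A. pnorm (\<zeta> x)))) = w * exp (- \<beta> * pnorm k)"
        by (simp add: w_def exp_add[symmetric] algebra_simps)
      also have "(2::real) ^ card (unexplored n (insert y A) Z) \<le> 2 ^ (c - 1 + (d + 2))"
        using U2 by (intro power_increasing) auto
      finally show "prob_n n {u \<in> E. u y = k} \<le> w * 2 ^ (c - 1 + (d + 2)) * exp (- \<beta> * pnorm k)"
        by (simp add: w_def mult_ac)
    qed (simp add: w_def)
    moreover have "prob_n n E = prob_n n {u \<in> E. u y = 0} + prob_n n {u \<in> E. u y \<noteq> 0}"
      by (subst measure_pmf.finite_measure_Union[symmetric]) (auto intro: arg_cong[where f = "prob_n n"])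
    \<comment> \<open>The \<open>d + 2\<close> possible new neighbours cost
      \<open>2 ^ (d + 2)\<close>, which \<open>\<theta>\<close> absorbs. Both outcomes at
      \<open>y\<close> are then bounded by \<open>w * 2 ^ (c - 1)\<close>, and their sum restores
      the factor 2 charged to \<open>y\<close>.\<close>
    moreover have "w * 2 ^ (c - 1 + (d + 2)) * \<theta> \<le> w * 2 ^ (c - 1)"
      using mult_left_mono[OF \<theta>_small, of "w * 2 ^ (c - 1)"] by (simp add: w_def power_add mult_ac)
    moreover have "w * 2 ^ (c - 1) + w * 2 ^ (c - 1) = w * 2 ^ c"
      using c by (cases c) auto
    ultimately show ?thesis unfolding E_def w_def c_def by linarith
  qed
qed

text \<open>Prescribed zeros are forgotten and the exploration starts from the non-zero sites with
  no site known to vanish; bounding their neighbours by \<open>d + 2\<close> each gives the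
  prefactor. A non-zero value outside the ball has probability zero.\<close>

lemma peierls_cylinder:
  assumes "finite A"
  shows "prob_n n {u. \<forall>x\<in>A. u x = \<zeta> x} \<le> 2 ^ ((d + 2) * card A) * exp (- \<beta> * (\<Sum>x\<in>A. pnorm (\<zeta> x)))"
proof -
  let ?A = "{x \<in> A. \<zeta> x \<noteq> 0}"
  have *: "prob_n n {u. \<forall>x\<in>A. u x = \<zeta> x} \<le> prob_n n {u. \<forall>x\<in>?A. u x = \<zeta> x}"
    by (rule measure_pmf.finite_measure_mono) auto
  show ?thesis
  proof (cases "?A \<subseteq> ball n")
    case True
    note *
    also have "prob_n n {u. \<forall>x\<in>?A. u x = \<zeta> x} \<le> exp (- \<beta> * (\<Sum>x\<in>?A. pnorm (\<zeta> x))) * 2 ^ card (unexplored n ?A {})"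
      using peierls_exploration[OF True, of \<zeta> "{}"] by simp
    also have "(\<Sum>x\<in>?A. pnorm (\<zeta> x)) = (\<Sum>x\<in>A. pnorm (\<zeta> x))"
      using assms p by (intro sum.mono_neutral_left) auto
    also have "card (unexplored n ?A {}) \<le> (d + 2) * card A"
    proof -
      have "unexplored n ?A {} \<subseteq> (\<Union>x\<in>A. {y. tree_adj d x y})" by (auto simp: unexplored_def)
      then have "card (unexplored n ?A {}) \<le> card (\<Union>x\<in>A. {y. tree_adj d x y})"
        using assms by (intro card_mono) auto
      also have "\<dots> \<le> (\<Sum>x\<in>A. card {y. tree_adj d x y})" by (rule card_UN_le[OF assms])
      also have "\<dots> \<le> (\<Sum>x\<in>A. d + 2)" by (intro sum_mono card_tree_neighbours)
      finally show ?thesis by (simp add: mult.commute)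
    qed
    then have "(2::real) ^ card (unexplored n ?A {}) \<le> 2 ^ ((d + 2) * card A)"
      by (intro power_increasing) auto
    finally show ?thesis by (simp add: mult.commute)
  next
    case False
    then obtain x where "x \<in> A" "\<zeta> x \<noteq> 0" "x \<notin> ball n" by auto
    then have "{u. \<forall>x\<in>A. u x = \<zeta> x} \<inter> set_pmf (finite_volume n) = {}"
      using finite_volume_support by force
    then have "prob_n n {u. \<forall>x\<in>A. u x = \<zeta> x} = 0"
      by (simp add: measure_pmf_zero_iff Int_commute)
    then show ?thesis by simp
  qed
qed

text \<open>The values on \<open>S\<close> are summed out one site at a time. A site moved from
  \<open>S\<close> to \<open>A\<close> with value \<open>k\<close> brings the factor 2^(d+2)
  exp(-\<beta> |k|^p), and summing over \<open>k \<noteq> 0\<close> turns it into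
  \<open>2 ^ (d + 2) * \<theta>\<close>; hence the statement carries a prescribed part
  \<open>A\<close> along.\<close>

lemma peierls_nonzero_aux:
  assumes "finite S" "finite A" "A \<inter> S = {}"
  shows "prob_n n {u. (\<forall>x\<in>A. u x = \<zeta> x) \<and> (\<forall>x\<in>S. u x \<noteq> 0)}
    \<le> 2 ^ ((d + 2) * card A) * exp (- \<beta> * (\<Sum>x\<in>A. pnorm (\<zeta> x))) * (2 ^ (d + 2) * \<theta>) ^ card S"
  using assms
proof (induction S arbitrary: A \<zeta> rule: finite_induct)
  case empty
  then show ?case using peierls_cylinder[of A n \<zeta>] by simp
next
  case (insert y S)
  define E where "E = {u. (\<forall>x\<in>A. u x = \<zeta> x) \<and> (\<forall>x\<in>S. u x \<noteq> 0)}"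
  let ?w = "2 ^ ((d + 2) * card A) * exp (- \<beta> * (\<Sum>x\<in>A. pnorm (\<zeta> x)))"
  have y: "y \<notin> A" using insert.prems by auto
  have "prob_n n {u \<in> E. u y \<noteq> 0} \<le> ?w * (2 ^ (d + 2) * \<theta>) ^ card S * 2 ^ (d + 2) * \<theta>"
  proof (rule prob_n_sum_nonzero_le)
    fix k :: int
    have "{u \<in> E. u y = k} = {u. (\<forall>x\<in>insert y A. u x = (\<zeta>(y := k)) x) \<and> (\<forall>x\<in>S. u x \<noteq> 0)}"
      using y by (auto simp: E_def)
    moreover have "finite (insert y A)" "insert y A \<inter> S = {}" using insert by auto
    note insert.IH[OF this, of "\<zeta>(y := k)"]
    ultimately have "prob_n n {u \<in> E. u y = k} \<le> 2 ^ ((d + 2) * card (insert y A))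
        * exp (- \<beta> * (\<Sum>x\<in>insert y A. pnorm ((\<zeta>(y := k)) x))) * (2 ^ (d + 2) * \<theta>) ^ card S"
      by simp
    also have "(\<Sum>x\<in>insert y A. pnorm ((\<zeta>(y := k)) x)) = pnorm k + (\<Sum>x\<in>A. pnorm (\<zeta> x))"
      using y insert.prems by (simp, intro sum.cong) auto
    also have "exp (- \<beta> * (pnorm k + (\<Sum>x\<in>A. pnorm (\<zeta> x))))
      = exp (- \<beta> * (\<Sum>x\<in>A. pnorm (\<zeta> x))) * exp (- \<beta> * pnorm k)"
      by (simp add: exp_add[symmetric] algebra_simps)
    finally show "prob_n n {u \<in> E. u y = k}
      \<le> ?w * (2 ^ (d + 2) * \<theta>) ^ card S * 2 ^ (d + 2) * exp (- \<beta> * pnorm k)"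
      using y insert.prems by (simp add: power_add mult_ac)
  qed (use \<theta>(1) in simp)
  moreover have "{u \<in> E. u y \<noteq> 0} = {u. (\<forall>x\<in>A. u x = \<zeta> x) \<and> (\<forall>x\<in>insert y S. u x \<noteq> 0)}"
    by (auto simp: E_def)
  ultimately show ?case using insert.hyps by (simp add: mult_ac)
qed

lemma peierls_nonzero:
  "finite S \<Longrightarrow> prob_n n {u. \<forall>x\<in>S. u x \<noteq> 0} \<le> (2 ^ (d + 2) * \<theta>) ^ card S"
  using peierls_nonzero_aux[of S "{}" n] by simp

end

subsection \<open>Infinite-volume limit\<close>

text \<open>Diagonal extraction along an enumeration of the index type, each stage by compactness of
  [0, 1].\<close>

lemma countable_family_convergent_subseq:
  fixes F :: "nat \<Rightarrow> 'a::countable \<Rightarrow> real"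
  assumes "\<And>n x. 0 \<le> F n x" "\<And>n x. F n x \<le> 1"
  shows "\<exists>r. strict_mono r \<and> (\<forall>x. convergent (\<lambda>n. F (r n) x))"
proof -
  interpret subseqs "\<lambda>k s. convergent (\<lambda>n. F (s n) (from_nat k))"
  proof
    fix k and s :: "nat \<Rightarrow> nat"
    have "compact {0..1::real}" by simp
    moreover have "\<forall>n. F (s n) (from_nat k) \<in> {0..1}" using assms by auto
    ultimately obtain l r where "strict_mono r" "((\<lambda>n. F (s n) (from_nat k)) \<circ> r) \<longlonglongrightarrow> l"
      unfolding compact_def by meson
    then show "\<exists>r'. strict_mono r' \<and> convergent (\<lambda>n. F ((s \<circ> r') n) (from_nat k))"
      by (auto simp: convergent_def o_def)
  qed
  have "convergent (\<lambda>n. F (diagseq n) x)" for x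
  proof -
    have "convergent (\<lambda>n. F ((diagseq \<circ> (+) (Suc (to_nat x))) n) (from_nat (to_nat x)))"
    proof (rule diagseq_holds)
      fix r s :: "nat \<Rightarrow> nat" and k
      assume "strict_mono r" "convergent (\<lambda>n. F (s n) (from_nat k))"
      then show "convergent (\<lambda>n. F ((s \<circ> r) n) (from_nat k))"
        using convergent_subseq_convergent[of "\<lambda>n. F (s n) (from_nat k)" r] by (simp add: o_def)
    qed
    then show ?thesis
      using convergent_ignore_initial_segment[of "\<lambda>n. F (diagseq n) x" "Suc (to_nat x)"]
      by (simp add: o_def add.commute)
  qed
  with subseq_diagseq show ?thesis by blast
qed

text \<open>Marginals are kept as laws on total functions with value 0 off \<open>J\<close>, that
  is, no deviation. All finite sets then share one type, and iterated projections compose.\<close>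

definition zero_outside :: "'a set \<Rightarrow> ('a \<Rightarrow> int) \<Rightarrow> 'a \<Rightarrow> int" where
  "zero_outside J u = (\<lambda>x. if x \<in> J then u x else 0)"

lemma space_Omega: "space (Omega d) = PiE (cayley_V d) (\<lambda>_. UNIV)"
  by (simp add: Omega_def space_PiM)

context low_temperature_sos
begin

definition marginal :: "nat \<Rightarrow> nat list set \<Rightarrow> (nat list \<Rightarrow> int) pmf" where
  "marginal n J = map_pmf (zero_outside J) (finite_volume n)"

lemma pmf_marginal:
  "pmf (marginal n J) w = (if \<forall>x. x \<notin> J \<longrightarrow> w x = 0 then prob_n n {u. \<forall>x\<in>J. u x = w x} else 0)"
proof -
  define c where "c \<longleftrightarrow> (\<forall>x. x \<notin> J \<longrightarrow> w x = 0)"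
  have "zero_outside J -` {w} = (if c then {u. \<forall>x\<in>J. u x = w x} else {})"
    by (auto simp: c_def zero_outside_def fun_eq_iff)
  then show ?thesis unfolding c_def[symmetric] by (simp add: marginal_def pmf_map)
qed

text \<open>The right-hand side is free of \<open>n\<close>: this is the uniform domination that
  prevents loss of mass along the sequence of balls.\<close>

lemma pmf_marginal_le:
  assumes "finite J"
  shows "pmf (marginal n J) w
    \<le> 2 ^ ((d + 2) * card J) * spin_Z ^ card J * pmf (Pi_pmf J 0 (\<lambda>_. spin_pmf)) w"
proof (cases "\<forall>x. x \<notin> J \<longrightarrow> w x = 0")
  case True
  then have "pmf (marginal n J) w \<le> 2 ^ ((d + 2) * card J) * exp (- \<beta> * (\<Sum>x\<in>J. pnorm (w x)))"
    using peierls_cylinder[OF assms, of n w] by (subst pmf_marginal) (subst if_P)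
  also have "exp (- \<beta> * (\<Sum>x\<in>J. pnorm (w x))) = spin_Z ^ card J * pmf (Pi_pmf J 0 (\<lambda>_. spin_pmf)) w"
    using True by (intro exp_sum_eq_Pi_pmf assms) auto
  finally show ?thesis by (simp add: mult_ac)
next
  case False
  then have "pmf (marginal n J) w = 0" unfolding pmf_marginal by (rule if_not_P)
  then show ?thesis using spin_Z_pos by simp
qed

lemma ex_subsequence_marginals:
  "\<exists>r Q. strict_mono r \<and> (\<forall>J. finite J \<longrightarrow> (\<forall>B.
    (\<lambda>n. measure (measure_pmf (marginal (r n) J)) B) \<longlonglongrightarrow> measure (measure_pmf (Q J)) B))"
proof -
  \<comment> \<open>Lists of pairs (site, value) form a countable type, unlike functions on sites,
    so one diagonal sequence serves all cylinder events at once.\<close>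
  define F where "F n c = prob_n n {u. \<forall>(x, k)\<in>set c. u x = k}" for n and c :: "(nat list \<times> int) list"
  obtain r where r: "strict_mono r" "\<And>c. convergent (\<lambda>n. F (r n) c)"
    using countable_family_convergent_subseq[of F] by (auto simp: F_def)
  have conv: "convergent (\<lambda>n. pmf (marginal (r n) J) w)" if "finite J" for J w
  proof (cases "\<forall>x. x \<notin> J \<longrightarrow> w x = 0")
    case True
    obtain xs where xs: "set xs = J" using finite_list[OF \<open>finite J\<close>] by blast
    have "pmf (marginal n J) w = F n (map (\<lambda>x. (x, w x)) xs)" for n
      unfolding pmf_marginal if_P[OF True] F_def by (simp add: xs[symmetric])
    then show ?thesis using r(2) by simp
  next
    case False
    then have "pmf (marginal n J) w = 0" for n unfolding pmf_marginal by (rule if_not_P)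
    then show ?thesis by (simp add: convergent_const)
  qed
  have "\<exists>Q. \<forall>B. (\<lambda>n. measure (measure_pmf (marginal (r n) J)) B) \<longlonglongrightarrow> measure (measure_pmf Q) B"
    if "finite J" for J
  proof -
    have "(\<lambda>n. pmf (marginal (r n) J) w) \<longlonglongrightarrow> lim (\<lambda>n. pmf (marginal (r n) J) w)" for w
      using conv[OF that] by (simp add: convergent_LIMSEQ_iff)
    from pmf_dominated_limit[OF this pmf_marginal_le[OF that]] show ?thesis by blast
  qed
  then have "\<exists>Q. \<forall>J. finite J \<longrightarrow> (\<forall>B. (\<lambda>n. measure (measure_pmf (marginal (r n) J)) B) \<longlonglongrightarrow> measure (measure_pmf (Q J)) B)"
    by metis
  with r(1) show ?thesis by blast
qed

text \<open>Kolmogorov consistency survives the limit because convergence is available on every set,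
  in particular on the possibly infinite preimage of one configuration.\<close>

lemma zero_outside_limit_marginal:
  assumes lim: "\<And>J B. finite J \<Longrightarrow>
      (\<lambda>n. measure (measure_pmf (marginal (r n) J)) B) \<longlonglongrightarrow> measure (measure_pmf (Q J)) B"
    and J: "finite H" "J \<subseteq> H"
  shows "map_pmf (zero_outside J) (Q H) = Q J"
proof (rule pmf_eqI)
  fix w
  have "zero_outside J \<circ> zero_outside H = zero_outside J"
    using J by (auto simp: zero_outside_def fun_eq_iff)
  then have "map_pmf (zero_outside J) (marginal n H) = marginal n J" for n
    by (simp add: marginal_def map_pmf_comp o_def)
  then have "measure (measure_pmf (marginal n H)) (zero_outside J -` {w})
      = measure (measure_pmf (marginal n J)) {w}" for n
    by (metis measure_map_pmf)
  with lim[OF J(1), of "zero_outside J -` {w}"] lim[OF finite_subset[OF J(2,1)], of "{w}"]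
  have "measure (measure_pmf (Q H)) (zero_outside J -` {w}) = measure (measure_pmf (Q J)) {w}"
    using LIMSEQ_unique by force
  then show "pmf (map_pmf (zero_outside J) (Q H)) w = pmf (Q J) w"
    by (simp add: pmf_map measure_pmf_single)
qed

text \<open>Kolmogorov's extension theorem asks for a spin type of class \<open>polish_space\<close>, of which
  \<open>int\<close> is not an instance; the integers are embedded into the reals and recovered by \<open>floor\<close>.\<close>

lemma ex_limit_state:
  "\<exists>\<mu> r. prob_space \<mu> \<and> sets \<mu> = sets (Omega d) \<and> strict_mono r \<and>
    (\<forall>J R. finite J \<and> J \<subseteq> cayley_V d \<and> (\<forall>u v. (\<forall>x\<in>J. u x = v x) \<longrightarrow> R u = R v) \<longrightarrow>
      (\<lambda>n. prob_n (r n) {u. R u}) \<longlonglongrightarrow> measure \<mu> {\<sigma> \<in> space (Omega d). R (\<lambda>x. \<sigma> x - \<omega> x)})"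
proof -
  let ?V = "cayley_V d"
  obtain r Q where r: "strict_mono r"
    and lim: "\<And>J B. finite J \<Longrightarrow>
      (\<lambda>n. measure (measure_pmf (marginal (r n) J)) B) \<longlonglongrightarrow> measure (measure_pmf (Q J)) B"
    using ex_subsequence_marginals by blast
  have Q_proj: "map_pmf (zero_outside J) (Q H) = Q J" if "finite H" "J \<subseteq> H" for J H
    by (rule zero_outside_limit_marginal[OF _ that]) (rule lim)
  define emb' :: "nat list set \<Rightarrow> (nat list \<Rightarrow> int) \<Rightarrow> nat list \<Rightarrow> real" where
    "emb' J u = (\<lambda>x\<in>J. real_of_int (\<omega> x + u x))" for J u
  define P where "P J = distr (measure_pmf (Q J)) (PiM J (\<lambda>_. borel :: real measure)) (emb' J)" for J
  have emb'_meas: "emb' J \<in> measurable (measure_pmf q) (PiM J (\<lambda>_. borel :: real measure))" for J q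
    by (auto simp: emb'_def space_PiM)
  interpret PF: polish_projective ?V P
  proof (intro polish_projective.intro projective_family.intro)
    fix J assume "finite J" "J \<subseteq> ?V"
    show "prob_space (P J)"
      unfolding P_def by (rule measure_pmf.prob_space_distr[OF emb'_meas])
  next
    fix J H :: "nat list set" assume JH: "J \<subseteq> H" "finite H" "H \<subseteq> ?V"
    have "distr (P H) (PiM J (\<lambda>_. borel)) (\<lambda>f. restrict f J)
        = distr (measure_pmf (Q H)) (PiM J (\<lambda>_. borel)) ((\<lambda>f. restrict f J) \<circ> emb' H)"
      unfolding P_def using JH(1)
      by (intro distr_distr measurable_restrict_subset emb'_meas)
    also have "(\<lambda>f. restrict f J) \<circ> emb' H = emb' J \<circ> zero_outside J"
      using JH by (auto simp: emb'_def zero_outside_def fun_eq_iff restrict_def)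
    also have "distr (measure_pmf (Q H)) (PiM J (\<lambda>_. borel)) (emb' J \<circ> zero_outside J)
       = distr (distr (measure_pmf (Q H)) (count_space UNIV) (zero_outside J)) (PiM J (\<lambda>_. borel)) (emb' J)"
      by (rule distr_distr[symmetric]) (auto simp: emb'_def space_PiM)
    also have "\<dots> = P J"
      unfolding P_def Q_proj[OF JH(2,1), symmetric] map_pmf_rep_eq ..
    finally show "P J = distr (P H) (PiM J (\<lambda>_. borel)) (\<lambda>f. restrict f J)" ..
  qed
  \<comment> \<open>The map \<open>fl\<close> accepts every real configuration, so pushing forward
    the projective limit requires no proof that it is carried by integer values.\<close>
  define fl :: "nat list set \<Rightarrow> (nat list \<Rightarrow> real) \<Rightarrow> nat list \<Rightarrow> int" where
    "fl J f = (\<lambda>x\<in>J. \<lfloor>f x\<rfloor>)" for J f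
  have fl_meas: "fl J \<in> measurable (PiM J (\<lambda>_. borel)) (PiM J (\<lambda>_. count_space UNIV))" for J
    unfolding fl_def by (intro measurable_restrict) measurable
  then have fl_meas': "fl ?V \<in> measurable PF.lim (Omega d)"
    unfolding Omega_def by (simp add: measurable_cong_sets[OF PF.sets_lim refl])
  define \<mu> where "\<mu> = distr PF.lim (Omega d) (fl ?V)"
  have "(\<lambda>n. prob_n (r n) {u. R u}) \<longlonglongrightarrow> measure \<mu> {\<sigma> \<in> space (Omega d). R (\<lambda>x. \<sigma> x - \<omega> x)}"
    if J: "finite J" "J \<subseteq> ?V" and R: "\<forall>u v. (\<forall>x\<in>J. u x = v x) \<longrightarrow> R u = R v" for J R
  proof -
    \<comment> \<open>The local event is rewritten as an event for real configurations on
      \<open>J\<close>; its preimage under \<open>fl\<close> on the whole tree is the cylinder over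
      \<open>X\<close>.\<close>
    define X where "X = fl J -` {\<sigma> \<in> PiE J (\<lambda>_. UNIV). R (\<lambda>x. \<sigma> x - \<omega> x)} \<inter> space (PiM J (\<lambda>_. borel :: real measure))"
    have "{\<sigma> \<in> PiE J (\<lambda>_. UNIV). R (\<lambda>x. \<sigma> x - \<omega> x)} \<in> sets (PiM J (\<lambda>_. count_space (UNIV :: int set)))"
      using J(1) by (subst count_space_PiM_finite) auto
    then have X: "X \<in> sets (PiM J (\<lambda>_. borel))"
      unfolding X_def by (rule measurable_sets[OF fl_meas])
    have R_fl: "R (\<lambda>x. fl J f x - \<omega> x) = R (\<lambda>x. fl ?V f x - \<omega> x)" for f
      using J(2) R by (auto simp: fl_def subset_iff)
    have pre: "fl ?V -` {\<sigma> \<in> space (Omega d). R (\<lambda>x. \<sigma> x - \<omega> x)} \<inter> space PF.lim = PF.emb ?V J X"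
    proof -
      have "fl J (restrict f J) = fl J f" for f
        by (auto simp: fl_def fun_eq_iff)
      moreover have "fl J f \<in> PiE J (\<lambda>_. UNIV)" "fl ?V f \<in> space (Omega d)" for f
        by (auto simp: fl_def space_Omega)
      ultimately show ?thesis
        by (auto simp: prod_emb_def X_def R_fl[symmetric] space_PiM)
    qed
    have meas: "{\<sigma> \<in> space (Omega d). R (\<lambda>x. \<sigma> x - \<omega> x)} \<in> sets (Omega d)"
    proof -
      have "(\<lambda>\<sigma>. restrict \<sigma> J) \<in> measurable (Omega d) (PiM J (\<lambda>_. count_space UNIV))"
        unfolding Omega_def using J by (intro measurable_restrict_subset)
      moreover have "PiM J (\<lambda>_. count_space (UNIV :: int set)) = count_space (PiE J (\<lambda>_. UNIV))"
        using J(1) by (rule count_space_PiM_finite) simp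
      ultimately have "(\<lambda>\<sigma>. restrict \<sigma> J) -` {\<tau> \<in> PiE J (\<lambda>_. UNIV). R (\<lambda>x. \<tau> x - \<omega> x)} \<inter> space (Omega d) \<in> sets (Omega d)"
        by (intro measurable_sets) auto
      moreover have "R (\<lambda>x. restrict \<sigma> J x - \<omega> x) = R (\<lambda>x. \<sigma> x - \<omega> x)" for \<sigma> :: "nat list \<Rightarrow> int"
        using R by auto
      ultimately show ?thesis by (simp add: vimage_def Int_def conj_commute)
    qed
    have "emeasure \<mu> {\<sigma> \<in> space (Omega d). R (\<lambda>x. \<sigma> x - \<omega> x)} = emeasure (P J) X"
      unfolding \<mu>_def emeasure_distr[OF fl_meas' meas] pre using J X by (intro PF.emeasure_lim_emb)
    also have "\<dots> = emeasure (measure_pmf (Q J)) (emb' J -` X)"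
      unfolding P_def by (subst emeasure_distr[OF emb'_meas X]) simp
    also have "emb' J -` X = {u. R u}"
    proof -
      have "fl J (emb' J u) = (\<lambda>x\<in>J. \<omega> x + u x)" for u
        by (auto simp: fl_def emb'_def fun_eq_iff)
      moreover have "R (\<lambda>x. (\<lambda>x\<in>J. \<omega> x + u x) x - \<omega> x) = R u" for u
        using R by auto
      ultimately show ?thesis by (auto simp: X_def space_PiM emb'_def)
    qed
    finally have "measure \<mu> {\<sigma> \<in> space (Omega d). R (\<lambda>x. \<sigma> x - \<omega> x)} = measure (measure_pmf (Q J)) {u. R u}"
      by (simp add: measure_def)
    moreover have "measure (measure_pmf (marginal n J)) {u. R u} = prob_n n {u. R u}" for n
    proof -
      have "R (zero_outside J u) = R u" for u using R by (auto simp: zero_outside_def)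
      then show ?thesis by (simp add: marginal_def measure_map_pmf vimage_def)
    qed
    ultimately show ?thesis using lim[OF J(1), of "{u. R u}"] by simp
  qed
  moreover have "prob_space \<mu>" unfolding \<mu>_def by (rule PF.P.prob_space_distr[OF fl_meas'])
  moreover have "sets \<mu> = sets (Omega d)" by (simp add: \<mu>_def)
  ultimately show ?thesis using r by blast
qed

end

subsection \<open>Gibbs measures via cylinder probabilities\<close>

definition cylinder :: "nat \<Rightarrow> nat list set \<Rightarrow> (nat list \<Rightarrow> int) \<Rightarrow> (nat list \<Rightarrow> int) set" where
  "cylinder d A \<xi> = {\<sigma> \<in> space (Omega d). \<forall>x\<in>A. \<sigma> x = \<xi> x}"

lemma cylinder_cong: "(\<And>x. x \<in> A \<Longrightarrow> \<xi> x = \<xi>' x) \<Longrightarrow> cylinder d A \<xi> = cylinder d A \<xi>'"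
  by (auto simp: cylinder_def)

lemma sigma_algebra_F_sub: "sigma_algebra (space (Omega d)) (F_sub d W)"
  unfolding F_sub_def by (rule sigma_algebra_sigma_sets) auto

lemma F_sub_full: "F_sub d (cayley_V d) = sets (Omega d)"
  unfolding F_sub_def Omega_def space_PiM sets_PiM_single by simp

lemma F_sub_mono: "W \<subseteq> W' \<Longrightarrow> F_sub d W \<subseteq> F_sub d W'"
  unfolding F_sub_def by (intro sigma_sets_mono') auto

lemma F_sub_sets: "W \<subseteq> cayley_V d \<Longrightarrow> F_sub d W \<subseteq> sets (Omega d)"
  using F_sub_mono[of W "cayley_V d" d] by (simp add: F_sub_full)

lemma cylinder_F_sub:
  assumes "finite A" "A \<subseteq> W"
  shows "cylinder d A \<xi> \<in> F_sub d W"
proof -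
  interpret sigma_algebra "space (Omega d)" "F_sub d W" by (rule sigma_algebra_F_sub)
  have "{\<sigma> \<in> space (Omega d). \<sigma> x = \<xi> x} \<in> F_sub d W" if "x \<in> A" for x
  proof -
    have "{\<sigma> \<in> space (Omega d). \<sigma> x \<in> {\<xi> x}} \<in> F_sub d W"
      unfolding F_sub_def using that assms(2) by (intro sigma_sets.Basic) blast
    then show ?thesis by simp
  qed
  then show ?thesis unfolding cylinder_def using assms(1) by (rule sets_Collect_finite_All)
qed

lemma cylinder_sets:
  assumes "finite A" "A \<subseteq> cayley_V d"
  shows "cylinder d A \<xi> \<in> sets (Omega d)"
  using cylinder_F_sub[OF assms, of d \<xi>] by (simp only: F_sub_full)

lemma countable_PiE_int: "finite A \<Longrightarrow> countable (PiE A (\<lambda>_. UNIV :: int set))"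
  by (rule countable_PiE) auto

text \<open>These generate the events outside \<open>\<Lambda>\<close>. Radius \<open>Suc n\<close>
  includes every neighbour of the ball of radius \<open>n\<close>, so once that ball contains
  \<open>\<Lambda>\<close> the kernel is constant on each cylinder; the threshold \<open>N\<close>
  ensures this. The empty set is added for stability under intersections.\<close>

definition ball_cylinders :: "nat \<Rightarrow> nat list set \<Rightarrow> nat \<Rightarrow> (nat list \<Rightarrow> int) set set" where
  "ball_cylinders d \<Lambda> N = insert {} {cylinder d (tree_ball d (Suc n) - \<Lambda>) \<xi> | n \<xi>. N \<le> n}"

lemma ball_cylinders_subset: "ball_cylinders d \<Lambda> N \<subseteq> Pow (space (Omega d))"
  by (auto simp: ball_cylinders_def cylinder_def)

text \<open>Prescriptions on two concentric balls either contradict each other somewhere, or the one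
  on the larger ball implies the other.\<close>

lemma Int_stable_ball_cylinders: "Int_stable (ball_cylinders d \<Lambda> N)"
proof (rule Int_stableI)
  have *: "cylinder d (tree_ball d (Suc n) - \<Lambda>) \<xi> \<inter> cylinder d (tree_ball d (Suc m) - \<Lambda>) \<zeta> \<in> ball_cylinders d \<Lambda> N"
    if "N \<le> n" "n \<le> m" for n m \<xi> \<zeta>
  proof (cases "\<forall>x \<in> tree_ball d (Suc n) - \<Lambda>. \<xi> x = \<zeta> x")
    case True
    then have "cylinder d (tree_ball d (Suc n) - \<Lambda>) \<xi> \<inter> cylinder d (tree_ball d (Suc m) - \<Lambda>) \<zeta>
      = cylinder d (tree_ball d (Suc m) - \<Lambda>) \<zeta>"
      using tree_ball_mono[of "Suc n" "Suc m" d] that by (auto simp: cylinder_def)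
    then show ?thesis using that by (auto simp: ball_cylinders_def)
  next
    case False
    then obtain x where "x \<in> tree_ball d (Suc n)" "x \<notin> \<Lambda>" "\<xi> x \<noteq> \<zeta> x" by auto
    then have "cylinder d (tree_ball d (Suc n) - \<Lambda>) \<xi> \<inter> cylinder d (tree_ball d (Suc m) - \<Lambda>) \<zeta> = {}"
      using subsetD[OF tree_ball_mono[of "Suc n" "Suc m" d], of x] that
      by (auto simp: cylinder_def dest!: bspec[where x = x])
    then show ?thesis by (simp add: ball_cylinders_def)
  qed
  fix a b assume "a \<in> ball_cylinders d \<Lambda> N" "b \<in> ball_cylinders d \<Lambda> N"
  then consider "a = {} \<or> b = {}"
    | n \<xi> m \<zeta> where "N \<le> n" "N \<le> m" "a = cylinder d (tree_ball d (Suc n) - \<Lambda>) \<xi>"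
        "b = cylinder d (tree_ball d (Suc m) - \<Lambda>) \<zeta>"
    by (auto simp: ball_cylinders_def)
  then show "a \<inter> b \<in> ball_cylinders d \<Lambda> N"
  proof cases
    case 1
    then show ?thesis by (auto simp: ball_cylinders_def)
  next
    case 2
    then show ?thesis using *[of n m \<xi> \<zeta>] *[of m n \<zeta> \<xi>] by (cases "n \<le> m") (auto simp: Int_commute)
  qed
qed

lemma UN_cylinder:
  "{\<sigma> \<in> space (Omega d). P (restrict \<sigma> A)} = (\<Union>\<xi>\<in>{\<xi> \<in> PiE A (\<lambda>_. UNIV). P \<xi>}. cylinder d A \<xi>)"
proof (intro equalityI subsetI)
  fix \<sigma> assume "\<sigma> \<in> {\<sigma> \<in> space (Omega d). P (restrict \<sigma> A)}"
  then show "\<sigma> \<in> (\<Union>\<xi>\<in>{\<xi> \<in> PiE A (\<lambda>_. UNIV). P \<xi>}. cylinder d A \<xi>)"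
    by (intro UN_I[of "restrict \<sigma> A"]) (auto simp: cylinder_def)
next
  fix \<sigma> assume "\<sigma> \<in> (\<Union>\<xi>\<in>{\<xi> \<in> PiE A (\<lambda>_. UNIV). P \<xi>}. cylinder d A \<xi>)"
  then obtain \<xi> where \<xi>: "\<xi> \<in> PiE A (\<lambda>_. UNIV)" "P \<xi>" "\<sigma> \<in> space (Omega d)" "\<forall>x\<in>A. \<sigma> x = \<xi> x"
    by (auto simp: cylinder_def)
  then have "restrict \<sigma> A = \<xi>" by (auto simp: fun_eq_iff PiE_def extensional_def)
  with \<xi> show "\<sigma> \<in> {\<sigma> \<in> space (Omega d). P (restrict \<sigma> A)}" by simp
qed

lemma F_sub_subset_ball_cylinders:
  "F_sub d (cayley_V d - \<Lambda>) \<subseteq> sigma_sets (space (Omega d)) (ball_cylinders d \<Lambda> N)"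
  unfolding F_sub_def
proof (rule sigma_sets_mono, safe)
  fix v A assume v: "v \<in> cayley_V d" "v \<notin> \<Lambda>"
  define n where "n = max N (length v)"
  define B where "B = tree_ball d (Suc n) - \<Lambda>"
  have "v \<in> B" using v by (auto simp: B_def n_def tree_ball_def)
  then have "{\<sigma> \<in> space (Omega d). \<sigma> v \<in> A} = {\<sigma> \<in> space (Omega d). restrict \<sigma> B v \<in> A}" by simp
  also have "\<dots> = \<Union> (cylinder d B ` {\<xi> \<in> PiE B (\<lambda>_. UNIV). \<xi> v \<in> A})"
    using UN_cylinder[of d "\<lambda>\<sigma>. \<sigma> v \<in> A" B] by simp
  also have "\<dots> \<in> sigma_sets (space (Omega d)) (ball_cylinders d \<Lambda> N)"
  proof (rule sigma_sets_UNION)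
    show "countable (cylinder d B ` {\<xi> \<in> PiE B (\<lambda>_. UNIV). \<xi> v \<in> A})"
      by (intro countable_image countable_subset[OF _ countable_PiE_int[of B]]) (auto simp: B_def)
    show "b \<in> sigma_sets (space (Omega d)) (ball_cylinders d \<Lambda> N)"
      if "b \<in> cylinder d B ` {\<xi> \<in> PiE B (\<lambda>_. UNIV). \<xi> v \<in> A}" for b
      using that by (intro sigma_sets.Basic) (auto simp: ball_cylinders_def B_def n_def intro!: exI[of _ n])
  qed
  finally show "{\<omega> \<in> space (Omega d). \<omega> v \<in> A} \<in> sigma_sets (space (Omega d)) (ball_cylinders d \<Lambda> N)" .
qed

text \<open>Uniqueness on an intersection-stable generator. Equality of the total masses is derived
  from one radius, whose cylinders form a countable partition of the space. The measures are finite
  rather than normalised because densities of a Gibbs measure will be compared.\<close>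

lemma measure_eqI_ball_cylinders:
  assumes "finite_measure \<mu>" "finite_measure \<nu>" "sets \<mu> = sets (Omega d)" "sets \<nu> = sets (Omega d)"
    and eq: "\<And>n \<xi>. N \<le> n \<Longrightarrow> emeasure \<mu> (cylinder d (tree_ball d (Suc n) - \<Lambda>) \<xi>)
        = emeasure \<nu> (cylinder d (tree_ball d (Suc n) - \<Lambda>) \<xi>)"
    and A: "A \<in> F_sub d (cayley_V d - \<Lambda>)"
  shows "emeasure \<mu> A = emeasure \<nu> A"
proof -
  interpret m: finite_measure \<mu> by fact
  interpret n: finite_measure \<nu> by fact
  let ?\<Omega> = "space (Omega d)" and ?G = "ball_cylinders d \<Lambda> N"
  have sp: "space \<mu> = ?\<Omega>" "space \<nu> = ?\<Omega>" using assms(3,4) by (auto dest: sets_eq_imp_space_eq)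
  have "?G \<subseteq> sets (Omega d)"
    by (auto simp: ball_cylinders_def intro!: cylinder_sets subset_trans[OF _ tree_ball_subset])
  then have sub: "sigma_sets ?\<Omega> ?G \<subseteq> sets (Omega d)" by (rule sets.sigma_sets_subset)
  have full: "emeasure \<mu> ?\<Omega> = emeasure \<nu> ?\<Omega>"
  proof -
    define B where "B = tree_ball d (Suc N) - \<Lambda>"
    have un: "?\<Omega> = (\<Union>\<xi>\<in>PiE B (\<lambda>_. UNIV). cylinder d B \<xi>)"
      using UN_cylinder[of d "\<lambda>_. True" B] by simp
    have c: "cylinder d B \<xi> \<in> sets (Omega d)" for \<xi>
      by (rule cylinder_sets) (use tree_ball_subset in \<open>auto simp: B_def\<close>)
    have "countable (PiE B (\<lambda>_. UNIV :: int set))" by (rule countable_PiE_int) (simp add: B_def)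
    moreover have "disjoint_family_on (cylinder d B) (PiE B (\<lambda>_. UNIV))"
      unfolding disjoint_family_on_def
    proof (intro ballI impI)
      fix \<xi> \<zeta> :: "nat list \<Rightarrow> int"
      assume "\<xi> \<in> PiE B (\<lambda>_. UNIV)" "\<zeta> \<in> PiE B (\<lambda>_. UNIV)" "\<xi> \<noteq> \<zeta>"
      then obtain x where "x \<in> B" "\<xi> x \<noteq> \<zeta> x" by (metis PiE_ext)
      then show "cylinder d B \<xi> \<inter> cylinder d B \<zeta> = {}" by (auto simp: cylinder_def)
    qed
    ultimately show ?thesis
      unfolding un using c eq[of N] assms(3,4) by (subst (1 2) emeasure_UN_countable) (auto simp: B_def)
  qed
  show ?thesis
  proof (rule sigma_sets_induct_disjoint[OF Int_stable_ball_cylinders ball_cylinders_subset])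
    show "A \<in> sigma_sets ?\<Omega> ?G" using A F_sub_subset_ball_cylinders by blast
    show "emeasure \<mu> A = emeasure \<nu> A" if "A \<in> ?G" for A
      using that eq by (auto simp: ball_cylinders_def)
    show "emeasure \<mu> (?\<Omega> - A) = emeasure \<nu> (?\<Omega> - A)"
      if "A \<in> sigma_sets ?\<Omega> ?G" "emeasure \<mu> A = emeasure \<nu> A" for A
    proof -
      have "A \<in> sets \<mu>" "A \<in> sets \<nu>" using that(1) sub assms(3,4) by auto
      then show ?thesis
        using emeasure_compl[of A \<mu>] emeasure_compl[of A \<nu>] that(2) full by (simp add: sp)
    qed
    show "emeasure \<mu> (\<Union>i. A i) = emeasure \<nu> (\<Union>i. A i)"
      if "disjoint_family A" "range A \<subseteq> sigma_sets ?\<Omega> ?G" "\<And>i. emeasure \<mu> (A i) = emeasure \<nu> (A i)"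
      for A :: "nat \<Rightarrow> _"
    proof -
      have "range A \<subseteq> sets \<mu>" "range A \<subseteq> sets \<nu>" using that(2) sub assms(3,4) by auto
      then show ?thesis using that(1,3) by (simp add: suminf_emeasure[symmetric])
    qed
  qed simp
qed

section \<open>Local functions and finite-dimensional marginals\<close>

lemma measurable_restrict_finite:
  assumes "finite D" "D \<subseteq> cayley_V d"
  shows "(\<lambda>\<sigma>. restrict \<sigma> D) \<in> measurable (Omega d) (count_space UNIV)"
proof -
  have "(\<lambda>\<sigma>. restrict \<sigma> D) \<in> measurable (Omega d) (PiM D (\<lambda>_. count_space UNIV))"
    unfolding Omega_def using assms by (intro measurable_restrict_subset)
  also have "PiM D (\<lambda>_. count_space (UNIV :: int set)) = count_space (PiE D (\<lambda>_. UNIV))"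
    using assms(1) by (rule count_space_PiM_finite) simp
  finally show ?thesis
    by (rule measurable_compose) simp
qed

lemma borel_measurable_local:
  fixes f :: "(nat list \<Rightarrow> int) \<Rightarrow> real"
  assumes D: "finite D" "D \<subseteq> cayley_V d" and f: "\<And>\<sigma> \<tau>. (\<And>x. x \<in> D \<Longrightarrow> \<sigma> x = \<tau> x) \<Longrightarrow> f \<sigma> = f \<tau>"
  shows "f \<in> borel_measurable (Omega d)"
proof -
  have "(\<lambda>\<sigma>. f (restrict \<sigma> D)) \<in> borel_measurable (Omega d)"
    by (rule measurable_compose[OF measurable_restrict_finite[OF D]]) simp
  moreover have "f (restrict \<sigma> D) = f \<sigma>" for \<sigma> by (rule f) simp
  ultimately show ?thesis by simp
qed

text \<open>A finite marginal lives on the countable set of extensional functions and is therefore a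
  discrete law. Conditional sums and independent copies can then be treated pointwise.\<close>

lemma ex_marginal_pmf:
  assumes "prob_space \<mu>" "sets \<mu> = sets (Omega d)" and D: "finite D" "D \<subseteq> cayley_V d"
  shows "\<exists>a. (\<forall>S. measure (measure_pmf a) S = measure \<mu> {\<sigma> \<in> space (Omega d). restrict \<sigma> D \<in> S}) \<and>
    (\<forall>\<sigma>. pmf a \<sigma> = (if \<sigma> \<in> extensional D then measure \<mu> (cylinder d D \<sigma>) else 0))"
proof -
  interpret prob_space \<mu> by fact
  have sp: "space \<mu> = space (Omega d)" using assms(2) by (rule sets_eq_imp_space_eq)
  have meas: "(\<lambda>\<sigma>. restrict \<sigma> D) \<in> measurable \<mu> (count_space UNIV)"
    using measurable_restrict_finite[OF D] by (simp add: measurable_cong_sets[OF assms(2) refl])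
  define N where "N = distr \<mu> (count_space UNIV) (\<lambda>\<sigma>. restrict \<sigma> D)"
  interpret N: prob_space N unfolding N_def by (rule prob_space_distr[OF meas])
  have "AE x in N. measure N {x} \<noteq> 0"
  proof (subst N.AE_support_countable)
    have "AE x in N. x \<in> PiE D (\<lambda>_. UNIV)"
      unfolding N_def by (subst AE_distr_iff[OF meas]) auto
    then show "\<exists>S. countable S \<and> (AE x in N. x \<in> S)"
      using countable_PiE_int[OF D(1)] by blast
  qed (simp add: N_def)
  moreover have "sets N = UNIV" by (simp add: N_def)
  ultimately have "measure_pmf (Abs_pmf N) = N"
    using N.prob_space_axioms by (intro Abs_pmf_inverse) simp
  then have 1: "measure (measure_pmf (Abs_pmf N)) S = measure \<mu> {\<sigma> \<in> space (Omega d). restrict \<sigma> D \<in> S}" for S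
    unfolding N_def using meas by (simp add: measure_distr sp vimage_def Int_def conj_commute)
  have "{\<tau> \<in> space (Omega d). restrict \<tau> D \<in> {\<sigma>}} = (if \<sigma> \<in> extensional D then cylinder d D \<sigma> else {})" for \<sigma>
    by (auto simp: cylinder_def fun_eq_iff extensional_def)
  then have "pmf (Abs_pmf N) \<sigma> = (if \<sigma> \<in> extensional D then measure \<mu> (cylinder d D \<sigma>) else 0)" for \<sigma>
    using 1[of "{\<sigma>}"] by (simp add: measure_pmf_single)
  with 1 show ?thesis by blast
qed

text \<open>The DLR equations in ratio form. They involve cylinder probabilities only
  and hence survive limits of finite-volume measures.\<close>

definition ratio_gibbs :: "nat \<Rightarrow> real \<Rightarrow> real \<Rightarrow> (nat list \<Rightarrow> int) measure \<Rightarrow> bool" where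
  "ratio_gibbs d p \<beta> \<mu> \<longleftrightarrow> (\<forall>n \<xi> \<xi>'. (\<forall>x. x \<notin> tree_ball d n \<longrightarrow> \<xi> x = \<xi>' x) \<longrightarrow>
     measure \<mu> (cylinder d (tree_ball d (Suc n)) \<xi>) * exp (- \<beta> * H_sos d p (tree_ball d n) \<xi>')
     = measure \<mu> (cylinder d (tree_ball d (Suc n)) \<xi>') * exp (- \<beta> * H_sos d p (tree_ball d n) \<xi>))"

section \<open>Equivalence of the DLR equations and their ratio form\<close>

lemma gamma_sos_cong:
  assumes "\<And>x y. x \<in> \<Lambda> \<Longrightarrow> tree_adj d x y \<Longrightarrow> y \<notin> \<Lambda> \<Longrightarrow> \<tau> y = \<tau>' y"
  shows "gamma_sos d p \<beta> \<Lambda> \<eta> \<tau> = gamma_sos d p \<beta> \<Lambda> \<eta> \<tau>'"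
proof -
  have "H_sos d p \<Lambda> (merge_cfg \<Lambda> \<zeta> \<tau>) = H_sos d p \<Lambda> (merge_cfg \<Lambda> \<zeta> \<tau>')" for \<zeta>
    by (rule H_sos_cong) (auto simp: merge_cfg_def assms)
  then show ?thesis by (simp add: gamma_sos_def)
qed

text \<open>On the event \<open>A\<close> all spins next to the ball are fixed, so the kernel is a
  constant with the same \<open>Z\<close> for \<open>\<xi>\<close> and \<open>\<xi>'\<close>. Both
  sides of the ratio equation become the same product of two Boltzmann factors, divided by
  \<open>Z\<close> and multiplied by the probability of \<open>A\<close>.\<close>

lemma gibbs_imp_ratio_gibbs:
  assumes "gibbs_sos d p \<beta> \<mu>"
  shows "ratio_gibbs d p \<beta> \<mu>"
  unfolding ratio_gibbs_def
proof (intro allI impI)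
  fix n and \<xi> \<xi>' :: "nat list \<Rightarrow> int"
  assume eq: "\<forall>x. x \<notin> tree_ball d n \<longrightarrow> \<xi> x = \<xi>' x"
  define \<Lambda> where "\<Lambda> = tree_ball d n"
  define A where "A = cylinder d (tree_ball d (Suc n) - \<Lambda>) \<xi>"
  define Z where "Z = (\<Sum>\<^sub>\<infinity>\<eta> \<in> PiE \<Lambda> (\<lambda>_. UNIV). exp (- \<beta> * H_sos d p \<Lambda> (merge_cfg \<Lambda> \<eta> \<xi>)))"
  have sets: "sets \<mu> = sets (Omega d)" using assms by (simp add: gibbs_sos_def)
  have A_F: "A \<in> F_sub d (cayley_V d - \<Lambda>)"
    unfolding A_def by (rule cylinder_F_sub) (use tree_ball_subset in auto)
  then have A_meas: "A \<in> sets \<mu>" using F_sub_sets[of "cayley_V d - \<Lambda>" d] sets by auto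
  have *: "measure \<mu> (cylinder d (tree_ball d (Suc n)) \<zeta>) = exp (- \<beta> * H_sos d p \<Lambda> \<zeta>) / Z * measure \<mu> A"
    if \<zeta>: "\<And>x. x \<notin> \<Lambda> \<Longrightarrow> \<zeta> x = \<xi> x" for \<zeta>
  proof -
    have "{\<sigma> \<in> space (Omega d). \<forall>v\<in>\<Lambda>. \<sigma> v = restrict \<zeta> \<Lambda> v} \<inter> A = cylinder d (tree_ball d (Suc n)) \<zeta>"
      using tree_ball_mono[of n "Suc n" d] \<zeta> by (auto simp: A_def cylinder_def \<Lambda>_def)
    moreover have "measure \<mu> ({\<sigma> \<in> space (Omega d). \<forall>v\<in>\<Lambda>. \<sigma> v = restrict \<zeta> \<Lambda> v} \<inter> A)
        = (\<integral>\<tau>. indicator A \<tau> * gamma_sos d p \<beta> \<Lambda> (restrict \<zeta> \<Lambda>) \<tau> \<partial>\<mu>)"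
    proof -
      have "finite \<Lambda>" "\<Lambda> \<subseteq> cayley_V d" "restrict \<zeta> \<Lambda> \<in> PiE \<Lambda> (\<lambda>_. UNIV)"
        using tree_ball_subset by (auto simp: \<Lambda>_def)
      with assms A_F show ?thesis unfolding gibbs_sos_def by blast
    qed
    moreover have "indicator A \<tau> * gamma_sos d p \<beta> \<Lambda> (restrict \<zeta> \<Lambda>) \<tau>
        = indicator A \<tau> * (exp (- \<beta> * H_sos d p \<Lambda> \<zeta>) / Z)" for \<tau>
    proof (cases "\<tau> \<in> A")
      case True
      have "gamma_sos d p \<beta> \<Lambda> (restrict \<zeta> \<Lambda>) \<tau> = gamma_sos d p \<beta> \<Lambda> (restrict \<zeta> \<Lambda>) \<xi>"
        by (rule gamma_sos_cong) (use True tree_adj_tree_ball in \<open>auto simp: A_def cylinder_def \<Lambda>_def\<close>)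
      also have "merge_cfg \<Lambda> (restrict \<zeta> \<Lambda>) \<xi> = \<zeta>"
        using \<zeta> by (auto simp: merge_cfg_def fun_eq_iff)
      then have "gamma_sos d p \<beta> \<Lambda> (restrict \<zeta> \<Lambda>) \<xi> = exp (- \<beta> * H_sos d p \<Lambda> \<zeta>) / Z"
        by (simp add: gamma_sos_def Z_def)
      finally show ?thesis by simp
    qed simp
    ultimately show ?thesis using A_meas
      by (simp add: mult.commute)
  qed
  show "measure \<mu> (cylinder d (tree_ball d (Suc n)) \<xi>) * exp (- \<beta> * H_sos d p (tree_ball d n) \<xi>')
     = measure \<mu> (cylinder d (tree_ball d (Suc n)) \<xi>') * exp (- \<beta> * H_sos d p (tree_ball d n) \<xi>)"
    using *[of \<xi>] *[of \<xi>'] eq by (simp add: \<Lambda>_def)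
qed

text \<open>The edges of the ball that do not meet \<open>\<Lambda>\<close> contribute one common
  positive factor, which is cancelled.\<close>

lemma ratio_gibbs_local:
  assumes "ratio_gibbs d p \<beta> \<mu>" "\<Lambda> \<subseteq> tree_ball d n" "\<And>x. x \<notin> \<Lambda> \<Longrightarrow> \<xi> x = \<xi>' x"
  shows "measure \<mu> (cylinder d (tree_ball d (Suc n)) \<xi>) * exp (- \<beta> * H_sos d p \<Lambda> \<xi>')
     = measure \<mu> (cylinder d (tree_ball d (Suc n)) \<xi>') * exp (- \<beta> * H_sos d p \<Lambda> \<xi>)"
proof -
  let ?H = "H_sos d p (tree_ball d n)"
  have "?H \<xi> - ?H \<xi>' = H_sos d p \<Lambda> \<xi> - H_sos d p \<Lambda> \<xi>'"
    using assms by (intro H_sos_diff_local) auto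
  then have "?H \<xi> = ?H \<xi>' + (H_sos d p \<Lambda> \<xi> - H_sos d p \<Lambda> \<xi>')" by simp
  then have "exp (- \<beta> * ?H \<xi>) = exp (- \<beta> * ?H \<xi>') * exp (- \<beta> * H_sos d p \<Lambda> \<xi>) / exp (- \<beta> * H_sos d p \<Lambda> \<xi>')"
    by (simp only: exp_add[symmetric] exp_diff[symmetric] ring_distribs) (simp add: algebra_simps)
  moreover have "measure \<mu> (cylinder d (tree_ball d (Suc n)) \<xi>) * exp (- \<beta> * ?H \<xi>')
     = measure \<mu> (cylinder d (tree_ball d (Suc n)) \<xi>') * exp (- \<beta> * ?H \<xi>)"
    using assms unfolding ratio_gibbs_def by blast
  moreover have "a * l' = b * l" if "e = e' * l / l'" "a * e' = b * e" "e' > 0" "l' > 0"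
    for a b e e' l l' :: real
  proof -
    have "a * e' = b * l / l' * e'" using that by simp
    with that(3) have "a = b * l / l'" by (metis less_irrefl mult_right_cancel)
    with that(4) show ?thesis by simp
  qed
  ultimately show ?thesis by (metis exp_gt_zero)
qed

text \<open>The ratio equations say that, with the exterior fixed, cylinder probabilities are
  proportional to Boltzmann weights. Summing over all interior configurations identifies the
  constant: the probabilities add up to that of the exterior cylinder and the weights to the
  partition function.\<close>

lemma ratio_gibbs_conditional:
  assumes "prob_space \<mu>" "sets \<mu> = sets (Omega d)" and ratio: "ratio_gibbs d p \<beta> \<mu>"
    and \<Lambda>: "\<Lambda> \<subseteq> tree_ball d n" and \<eta>: "\<eta> \<in> PiE \<Lambda> (\<lambda>_. UNIV)"
  shows "measure \<mu> (cylinder d (tree_ball d (Suc n)) (merge_cfg \<Lambda> \<eta> \<xi>))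
    = gamma_sos d p \<beta> \<Lambda> \<eta> \<xi> * measure \<mu> (cylinder d (tree_ball d (Suc n) - \<Lambda>) \<xi>)"
proof -
  define D where "D = tree_ball d (Suc n)"
  define I where "I = PiE \<Lambda> (\<lambda>_. UNIV :: int set)"
  define e where "e \<eta> = exp (- \<beta> * H_sos d p \<Lambda> (merge_cfg \<Lambda> \<eta> \<xi>))" for \<eta>
  define m where "m \<eta> = measure \<mu> (cylinder d D (merge_cfg \<Lambda> \<eta> \<xi>))" for \<eta>
  define \<mu>C where "\<mu>C = measure \<mu> (cylinder d (D - \<Lambda>) \<xi>)"
  have \<Lambda>D: "\<Lambda> \<subseteq> D" using \<Lambda> tree_ball_mono[of n "Suc n" d] by (auto simp: D_def)
  have D: "finite D" "D \<subseteq> cayley_V d" using tree_ball_subset by (auto simp: D_def)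
  obtain a where a: "\<And>S. measure (measure_pmf a) S = measure \<mu> {\<sigma> \<in> space (Omega d). restrict \<sigma> D \<in> S}"
    "\<And>\<sigma>. pmf a \<sigma> = (if \<sigma> \<in> extensional D then measure \<mu> (cylinder d D \<sigma>) else 0)"
    using ex_marginal_pmf[OF assms(1,2) D] by blast
  define S where "S = {\<sigma> \<in> extensional D. \<forall>x\<in>D - \<Lambda>. \<sigma> x = \<xi> x}"
  have bij: "bij_betw (\<lambda>\<eta>. restrict (merge_cfg \<Lambda> \<eta> \<xi>) D) I S"
  proof (rule bij_betwI[where g = "\<lambda>\<sigma>. restrict \<sigma> \<Lambda>"])
    show "restrict (restrict (merge_cfg \<Lambda> x \<xi>) D) \<Lambda> = x" if "x \<in> I" for x
      using that \<Lambda>D by (auto simp: I_def merge_cfg_def fun_eq_iff restrict_def PiE_def extensional_def)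
    show "restrict (merge_cfg \<Lambda> (restrict y \<Lambda>) \<xi>) D = y" if "y \<in> S" for y
      using that \<Lambda>D by (auto simp: S_def merge_cfg_def fun_eq_iff restrict_def extensional_def)
  qed (auto simp: S_def I_def merge_cfg_def)
  have pmf_a_m: "pmf a (restrict (merge_cfg \<Lambda> \<eta> \<xi>) D) = m \<eta>" for \<eta>
    by (auto simp: a(2) m_def intro!: arg_cong[where f = "measure \<mu>"] cylinder_cong)
  have "\<mu>C = measure (measure_pmf a) S"
    unfolding \<mu>C_def a(1) by (rule arg_cong[where f = "measure \<mu>"]) (auto simp: S_def cylinder_def)
  also have "\<dots> = infsetsum (pmf a) S" by (rule measure_pmf_conv_infsetsum)
  also have "\<dots> = infsetsum (\<lambda>\<eta>. pmf a (restrict (merge_cfg \<Lambda> \<eta> \<xi>) D)) I"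
    by (rule infsetsum_reindex_bij_betw[OF bij, symmetric])
  also have "(\<lambda>\<eta>. pmf a (restrict (merge_cfg \<Lambda> \<eta> \<xi>) D)) = m" by (simp add: pmf_a_m)
  also have "infsetsum m I = infsum m I"
  proof (rule infsetsum_infsum)
    show "Infinite_Set_Sum.abs_summable_on m I"
      using pmf_abs_summable[of a S] abs_summable_on_reindex_bij_betw[OF bij, of "pmf a"]
      by (simp only: pmf_a_m)
  qed
  finally have sum: "\<mu>C = infsum m I" .
  have r: "m \<eta>1 * e \<eta>2 = m \<eta>2 * e \<eta>1" for \<eta>1 \<eta>2
    unfolding m_def e_def D_def
    by (rule ratio_gibbs_local[OF ratio \<Lambda>]) (auto simp: merge_cfg_def)
  have gamma: "gamma_sos d p \<beta> \<Lambda> \<eta> \<xi> = e \<eta> / infsum e I"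
    unfolding gamma_sos_def I_def e_def[abs_def] ..
  have "m \<eta> = gamma_sos d p \<beta> \<Lambda> \<eta> \<xi> * \<mu>C"
  proof (cases "m \<eta> = 0")
    case True
    then have "m \<zeta> = 0" for \<zeta> using r[of \<eta> \<zeta>] by (simp add: e_def)
    then have "infsum m I = 0" by (intro infsum_0) auto
    then show ?thesis using sum True by simp
  next
    case False
    \<comment> \<open>Since \<open>e\<close> is a constant multiple of the summable family
      \<open>m\<close>, the value of the partition sum follows without a separate estimate.\<close>
    have "e \<zeta> = m \<zeta> * (e \<eta> / m \<eta>)" for \<zeta> using r[of \<eta> \<zeta>] False by (simp add: field_simps)
    then have "infsum e I = infsum (\<lambda>\<zeta>. m \<zeta> * (e \<eta> / m \<eta>)) I" by (rule infsum_cong)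
    also have "\<dots> = \<mu>C * (e \<eta> / m \<eta>)" unfolding sum by (rule infsum_cmult_left')
    finally have *: "infsum e I = \<mu>C * (e \<eta> / m \<eta>)" .
    have "m \<eta> \<le> \<mu>C"
    proof -
      interpret prob_space \<mu> by fact
      have "cylinder d (D - \<Lambda>) \<xi> \<in> sets \<mu>" unfolding assms(2) using D by (intro cylinder_sets) auto
      then show ?thesis unfolding m_def \<mu>C_def
        by (intro finite_measure_mono) (auto simp: cylinder_def merge_cfg_def)
    qed
    moreover have "m \<eta> > 0" using False by (simp add: m_def less_le)
    ultimately show ?thesis unfolding gamma * by (simp add: e_def field_simps)
  qed
  then show ?thesis by (simp add: m_def D_def \<mu>C_def)
qed

text \<open>For fixed \<open>\<Lambda>\<close> and \<open>\<eta>\<close> both sides of the DLR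
  equation are finite measures in \<open>A\<close>: the restriction of \<open>\<mu>\<close> to the
  event \<open>C\<close>, and the measure with density \<open>g\<close>. They agree on cylinders
  avoiding \<open>\<Lambda>\<close>, hence on all exterior events.\<close>

lemma ratio_gibbs_imp_gibbs:
  assumes "prob_space \<mu>" "sets \<mu> = sets (Omega d)" and ratio: "ratio_gibbs d p \<beta> \<mu>"
  shows "gibbs_sos d p \<beta> \<mu>"
  unfolding gibbs_sos_def
proof (intro conjI allI impI assms(1,2))
  fix \<Lambda> :: "nat list set" and \<eta> :: "nat list \<Rightarrow> int" and A
  assume asm: "finite \<Lambda> \<and> \<Lambda> \<subseteq> cayley_V d \<and> \<eta> \<in> PiE \<Lambda> (\<lambda>_. UNIV) \<and> A \<in> F_sub d (cayley_V d - \<Lambda>)"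
  then obtain N where N: "\<Lambda> \<subseteq> tree_ball d N" using finite_subset_tree_ball by blast
  interpret prob_space \<mu> by fact
  define C where "C = cylinder d \<Lambda> \<eta>"
  define g where "g = gamma_sos d p \<beta> \<Lambda> \<eta>"
  have C: "C \<in> sets \<mu>" using cylinder_sets asm assms(2) by (auto simp: C_def)
  have g_pos: "0 \<le> g \<tau>" for \<tau>
    by (auto simp: g_def gamma_sos_def intro!: divide_nonneg_nonneg infsum_nonneg)
  have g_le: "g \<tau> \<le> 1" for \<tau>
  proof -
    let ?e = "\<lambda>\<eta>. exp (- \<beta> * H_sos d p \<Lambda> (merge_cfg \<Lambda> \<eta> \<tau>))"
    \<comment> \<open>A divergent partition sum has the value 0, and division by it gives 0, so the
      kernel is at most 1 in that case too.\<close>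
    have "infsum ?e (PiE \<Lambda> (\<lambda>_. UNIV)) = 0 \<or> ?e \<eta> \<le> infsum ?e (PiE \<Lambda> (\<lambda>_. UNIV))"
    proof (cases "?e summable_on PiE \<Lambda> (\<lambda>_. UNIV)")
      case True
      then show ?thesis
        using finite_sum_le_infsum[OF True, of "{\<eta>}"] asm by auto
    next
      case False
      then show ?thesis by (simp add: infsum_not_exists)
    qed
    moreover have "0 < ?e \<eta>" by simp
    ultimately show ?thesis unfolding g_def gamma_sos_def
      by (auto simp del: exp_gt_zero intro: divide_le_eq_1[THEN iffD2])
  qed
  have g_meas: "g \<in> borel_measurable \<mu>"
  proof -
    have "g \<in> borel_measurable (Omega d)"
      unfolding g_def
      by (rule borel_measurable_local[of "tree_ball d (Suc N)"])
         (use N tree_adj_tree_ball tree_ball_subset in \<open>auto intro!: gamma_sos_cong\<close>)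
    then show ?thesis by (simp add: measurable_cong_sets[OF assms(2) refl])
  qed
  define N1 where "N1 = density \<mu> (indicator C)"
  define N2 where "N2 = density \<mu> (\<lambda>\<tau>. ennreal (g \<tau>))"
  have e1: "emeasure N1 B = emeasure \<mu> (C \<inter> B)" if "B \<in> sets \<mu>" for B
    unfolding N1_def using C that by (subst emeasure_density) (auto simp: indicator_inter_arith[symmetric])
  have e2: "emeasure N2 B = (\<integral>\<^sup>+\<tau>. ennreal (g \<tau>) * indicator B \<tau> \<partial>\<mu>)" if "B \<in> sets \<mu>" for B
    unfolding N2_def using g_meas that by (subst emeasure_density) auto
  have "emeasure N1 A = emeasure N2 A"
  proof (rule measure_eqI_ball_cylinders[where N = N])
    show "finite_measure N1"
    proof (rule finite_measureI)
      have "space N1 = space \<mu>" by (simp add: N1_def)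
      then show "emeasure N1 (space N1) \<noteq> \<infinity>" using e1[OF sets.top] by simp
    qed
    show "finite_measure N2"
    proof (rule finite_measureI)
      have "emeasure N2 (space \<mu>) \<le> (\<integral>\<^sup>+\<tau>. 1 \<partial>\<mu>)"
        unfolding e2[OF sets.top] by (intro nn_integral_mono) (auto simp: g_le)
      also have "\<dots> < \<infinity>" by (simp add: emeasure_space_1)
      finally show "emeasure N2 (space N2) \<noteq> \<infinity>" by (simp add: N2_def)
    qed
    show "sets N1 = sets (Omega d)" "sets N2 = sets (Omega d)" by (simp_all add: N1_def N2_def assms(2))
    show "A \<in> F_sub d (cayley_V d - \<Lambda>)" using asm by simp
    fix n \<xi> assume "N \<le> n"
    define B where "B = cylinder d (tree_ball d (Suc n) - \<Lambda>) \<xi>"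
    have B: "B \<in> sets \<mu>" unfolding B_def assms(2)
      by (rule cylinder_sets) (use tree_ball_subset in auto)
    have \<Lambda>n: "\<Lambda> \<subseteq> tree_ball d n" using N tree_ball_mono[OF \<open>N \<le> n\<close>] by blast
    have "C \<inter> B = cylinder d (tree_ball d (Suc n)) (merge_cfg \<Lambda> \<eta> \<xi>)"
      using \<Lambda>n tree_ball_mono[of n "Suc n" d] by (auto simp: B_def C_def cylinder_def merge_cfg_def)
    then have "emeasure N1 B = ennreal (g \<xi> * measure \<mu> B)"
      using ratio_gibbs_conditional[OF assms \<Lambda>n, of \<eta> \<xi>] asm B
      by (simp add: e1 emeasure_eq_measure B_def g_def)
    also have "\<dots> = (\<integral>\<^sup>+\<tau>. ennreal (g \<xi>) * indicator B \<tau> \<partial>\<mu>)"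
      using B g_pos by (simp add: nn_integral_cmult_indicator ennreal_mult emeasure_eq_measure)
    also have "\<dots> = (\<integral>\<^sup>+\<tau>. ennreal (g \<tau>) * indicator B \<tau> \<partial>\<mu>)"
    proof (rule nn_integral_cong)
      fix \<tau>
      have "g \<xi> = g \<tau>" if "\<tau> \<in> B"
        unfolding g_def
        by (rule gamma_sos_cong) (use that \<Lambda>n tree_adj_tree_ball in \<open>auto simp: B_def cylinder_def subset_iff\<close>)
      then show "ennreal (g \<xi>) * indicator B \<tau> = ennreal (g \<tau>) * indicator B \<tau>"
        by (auto simp: indicator_def)
    qed
    finally show "emeasure N1 (cylinder d (tree_ball d (Suc n) - \<Lambda>) \<xi>)
        = emeasure N2 (cylinder d (tree_ball d (Suc n) - \<Lambda>) \<xi>)"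
      using B e2 by (simp add: B_def)
  qed
  moreover have A: "A \<in> sets \<mu>" using asm F_sub_sets[of "cayley_V d - \<Lambda>" d] assms(2) by auto
  ultimately have "emeasure \<mu> (C \<inter> A) = (\<integral>\<^sup>+\<tau>. ennreal (g \<tau>) * indicator A \<tau> \<partial>\<mu>)"
    by (simp add: e1 e2)
  also have "\<dots> = (\<integral>\<^sup>+\<tau>. ennreal (indicator A \<tau> * g \<tau>) \<partial>\<mu>)"
    by (intro nn_integral_cong) (auto simp: indicator_def)
  finally have "measure \<mu> (C \<inter> A) = (\<integral>\<tau>. indicator A \<tau> * g \<tau> \<partial>\<mu>)"
    using A g_meas g_pos by (subst integral_eq_nn_integral) (auto simp: measure_def)
  then show "measure \<mu> ({\<sigma> \<in> space (Omega d). \<forall>v\<in>\<Lambda>. \<sigma> v = \<eta> v} \<inter> A)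
    = (\<integral>\<tau>. indicator A \<tau> * gamma_sos d p \<beta> \<Lambda> \<eta> \<tau> \<partial>\<mu>)"
    by (simp add: C_def g_def cylinder_def)
qed

subsection \<open>Extremality by swapping two independent copies\<close>

lemma measure_pair_pmf_Times:
  "measure (measure_pmf (pair_pmf a b)) (A \<times> B) = measure (measure_pmf a) A * measure (measure_pmf b) B"
proof -
  have "measure (measure_pmf (pair_pmf a b)) (A \<times> B)
      = measure (measure_pmf (pair_pmf a b)) ((A \<inter> set_pmf a) \<times> (B \<inter> set_pmf b))"
    by (subst measure_Int_set_pmf[symmetric]) (auto intro: arg_cong[where f = "measure _"])
  also have "\<dots> = measure (measure_pmf a) (A \<inter> set_pmf a) * measure (measure_pmf b) (B \<inter> set_pmf b)"
    by (intro measure_pmf_prob_product countable_Int2) auto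
  finally show ?thesis by (simp add: measure_Int_set_pmf)
qed

section \<open>The swap of two configurations in a ball\<close>

context
  fixes d n :: nat and \<omega> :: "nat list \<Rightarrow> int"
begin

definition disagree :: "(nat list \<Rightarrow> int) \<times> (nat list \<Rightarrow> int) \<Rightarrow> nat list \<Rightarrow> bool" where
  "disagree z x \<longleftrightarrow> fst z x \<noteq> \<omega> x \<or> snd z x \<noteq> \<omega> x"

text \<open>Escape is tested along descending branches only. The vertices of the branch from
  \<open>x\<close> to \<open>y\<close> are the prefixes of \<open>y\<close>, and a disagreement is
  required at both ends as well.\<close>

definition leads_out :: "(nat list \<Rightarrow> int) \<times> (nat list \<Rightarrow> int) \<Rightarrow> nat list \<Rightarrow> bool" where
  "leads_out z x \<longleftrightarrow> (\<exists>y\<in>cayley_V d. length y = n \<and> length x \<le> n \<and> take (length x) y = x \<and>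
     (\<forall>j\<in>{length x..n}. disagree z (take j y)))"

text \<open>A site is excluded as soon as it or one of its ancestors leads out. The region is thus
  closed under parents: it is empty or a subtree containing the root, and it can only be left from a
  parent to a child.\<close>

definition swap_region :: "(nat list \<Rightarrow> int) \<times> (nat list \<Rightarrow> int) \<Rightarrow> nat list set" where
  "swap_region z = {x \<in> tree_ball d n. \<forall>j\<le>length x. \<not> leads_out z (take j x)}"

definition swap :: "(nat list \<Rightarrow> int) \<times> (nat list \<Rightarrow> int) \<Rightarrow> (nat list \<Rightarrow> int) \<times> (nat list \<Rightarrow> int)" where
  "swap z = (\<lambda>x. if x \<in> swap_region z then snd z x else fst z x,
             \<lambda>x. if x \<in> swap_region z then fst z x else snd z x)"

lemma disagree_swap: "disagree (swap z) = disagree z"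
  by (auto simp: disagree_def swap_def fun_eq_iff)

lemma swap_region_swap: "swap_region (swap z) = swap_region z"
  by (simp add: swap_region_def leads_out_def disagree_swap)

text \<open>The region depends on the pair only through \<open>disagree\<close>, which is symmetric
  in the two copies, so the exchange leaves the region unchanged.\<close>

lemma swap_swap: "swap (swap z) = z"
proof -
  have "swap (swap z) = (\<lambda>x. if x \<in> swap_region z then snd (swap z) x else fst (swap z) x,
      \<lambda>x. if x \<in> swap_region z then fst (swap z) x else snd (swap z) x)"
    by (simp add: swap_def[of "swap z"] swap_region_swap)
  also have "\<dots> = z" by (rule prod_eqI) (auto simp: swap_def)
  finally show ?thesis .
qed

lemma swap_region_parent:
  assumes "child_pair d v w" "w \<in> swap_region z"
  shows "v \<in> swap_region z"
proof -
  obtain a where w: "w = v @ [a]" "v \<in> cayley_V d" using assms(1) by (auto simp: child_pair_def)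
  have "\<not> leads_out z (take j v)" if "j \<le> length v" for j
  proof -
    have "j \<le> length w" "take j w = take j v" using that w(1) by auto
    moreover have "\<forall>j\<le>length w. \<not> leads_out z (take j w)" using assms(2) unfolding swap_region_def by blast
    ultimately show ?thesis by metis
  qed
  then show ?thesis using assms(2) w by (auto simp: swap_region_def tree_ball_def)
qed

text \<open>If \<open>v\<close> stays in the region and its child \<open>w\<close> does not, then
  \<open>w\<close> is beyond level \<open>n\<close> or leads out itself. A disagreement at
  \<open>v\<close> would start an escaping branch, consisting of \<open>v\<close> alone in the first
  case and continuing through \<open>w\<close> in the second, so \<open>v\<close> would have been
  excluded.\<close>

lemma swap_region_boundary:
  assumes "child_pair d v w" "v \<in> swap_region z" "w \<notin> swap_region z"
  shows "\<not> disagree z v"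
proof
  assume dis: "disagree z v"
  obtain a where w: "w = v @ [a]" and V: "v \<in> cayley_V d" "w \<in> cayley_V d"
    using assms(1) by (auto simp: child_pair_def)
  have v: "length v \<le> n" "\<And>j. j \<le> length v \<Longrightarrow> \<not> leads_out z (take j v)"
    using assms(2) by (auto simp: swap_region_def tree_ball_def)
  then have nv: "\<not> leads_out z v" using v(2)[of "length v"] by simp
  show False
  proof (cases "length v = n")
    case True
    then have "leads_out z v" using dis V(1) by (auto simp: leads_out_def intro!: bexI[of _ v])
    with nv show False ..
  next
    case False
    then have "w \<in> tree_ball d n" using v(1) V(2) w by (auto simp: tree_ball_def)
    then obtain j where j: "j \<le> length w" "leads_out z (take j w)"
      using assms(3) by (auto simp: swap_region_def)
    have "j = length w"
    proof (rule ccontr)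
      assume "j \<noteq> length w"
      with j(1) w have "j \<le> length v" "take j w = take j v" by auto
      with v(2) j(2) show False by auto
    qed
    with j(2) have "leads_out z w" by simp
    then obtain y where y: "y \<in> cayley_V d" "length y = n" "length w \<le> n" "take (length w) y = w"
      "\<And>i. length w \<le> i \<Longrightarrow> i \<le> n \<Longrightarrow> disagree z (take i y)"
      by (auto simp: leads_out_def)
    have "take (length v) y = take (length v) (take (length w) y)" using w by (simp add: min_def)
    also have "\<dots> = v" unfolding y(4) using w by simp
    finally have tv: "take (length v) y = v" .
    have "disagree z (take i y)" if "length v \<le> i" "i \<le> n" for i
    proof (cases "i = length v")
      case True
      then show ?thesis using dis tv by simp
    next
      case False
      then show ?thesis using that y(5)[of i] w by simp
    qed
    with y(1-3) tv v(1) have "leads_out z v" unfolding leads_out_def by fastforce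
    with nv show False ..
  qed
qed

text \<open>Edges inside the region exchange their two contributions and edges outside keep them. On
  a boundary edge both copies equal \<open>\<omega>\<close> at the parent, so exchanging the
  parent's values has no effect there.\<close>

lemma H_sos_swap:
  "H_sos d p (tree_ball d n) (fst (swap z)) + H_sos d p (tree_ball d n) (snd (swap z))
    = H_sos d p (tree_ball d n) (fst z) + H_sos d p (tree_ball d n) (snd z)"
proof -
  let ?f = "\<lambda>\<xi> (v, w). \<bar>real_of_int (\<xi> v - \<xi> w)\<bar> powr p"
  have "?f (fst (swap z)) e + ?f (snd (swap z)) e = ?f (fst z) e + ?f (snd z) e"
    if e_mem: "e \<in> touching_edges d (tree_ball d n)" for e
  proof -
    obtain v w where e: "e = (v, w)" "child_pair d v w"
      using e_mem by (auto simp: touching_edges_def)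
    consider "v \<in> swap_region z" "w \<in> swap_region z" | "v \<notin> swap_region z" "w \<notin> swap_region z"
      | "v \<in> swap_region z" "w \<notin> swap_region z"
      using swap_region_parent[OF e(2)] by blast
    then show ?thesis
    proof cases
      case 3
      then have "fst z v = snd z v" using swap_region_boundary[OF e(2)] by (auto simp: disagree_def)
      with 3 show ?thesis by (simp add: e swap_def)
    qed (simp_all add: e swap_def)
  qed
  then show ?thesis unfolding H_sos_alt sum.distrib[symmetric] by (intro sum.cong) auto
qed

lemma swap_region_ball:
  assumes "\<not> tree_ball d m \<subseteq> swap_region z" "m \<le> n"
  shows "\<exists>y\<in>cayley_V d. length y = n \<and> (\<forall>j\<in>{m..n}. disagree z (take j y))"
proof -
  obtain x where x: "x \<in> tree_ball d m" "x \<notin> swap_region z" using assms(1) by auto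
  then have "x \<in> tree_ball d n" using tree_ball_mono[OF assms(2)] by auto
  with x obtain j where j: "j \<le> length x" "leads_out z (take j x)" by (auto simp: swap_region_def)
  moreover have "length x \<le> m" using x(1) by (simp add: tree_ball_def)
  ultimately show ?thesis unfolding leads_out_def by fastforce
qed

text \<open>The involution alters only sites of the ball of radius \<open>n\<close>, so the ratio
  equations apply to each copy. Multiplied together they compare pair weights by Boltzmann factors,
  whose product is preserved because the total energy is.\<close>

lemma pair_pmf_swap:
  assumes \<mu>: "ratio_gibbs d p \<beta> \<mu>" and \<nu>: "ratio_gibbs d p \<beta> \<nu>"
    and a: "\<And>\<sigma>. pmf a \<sigma> = (if \<sigma> \<in> extensional (tree_ball d (Suc n)) then measure \<mu> (cylinder d (tree_ball d (Suc n)) \<sigma>) else 0)"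
    and b: "\<And>\<sigma>. pmf b \<sigma> = (if \<sigma> \<in> extensional (tree_ball d (Suc n)) then measure \<nu> (cylinder d (tree_ball d (Suc n)) \<sigma>) else 0)"
  shows "map_pmf swap (pair_pmf a b) = pair_pmf a b"
proof (rule pmf_eqI)
  fix z :: "(nat list \<Rightarrow> int) \<times> (nat list \<Rightarrow> int)"
  let ?D = "tree_ball d (Suc n)" and ?w = "\<lambda>\<xi>. exp (- \<beta> * H_sos d p (tree_ball d n) \<xi>)"
  obtain \<sigma> \<sigma>' :: "nat list \<Rightarrow> int" where z: "z = (\<sigma>, \<sigma>')" by (cases z)
  obtain s s' where s: "swap z = (s, s')" by (cases "swap z")
  have inj: "inj swap" by (metis injI swap_swap)
  have off: "s x = \<sigma> x" "s' x = \<sigma>' x" if "x \<notin> tree_ball d n" for x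
    using s that by (auto simp: swap_def z swap_region_def)
  have ext: "s \<in> extensional ?D \<longleftrightarrow> \<sigma> \<in> extensional ?D" "s' \<in> extensional ?D \<longleftrightarrow> \<sigma>' \<in> extensional ?D"
  proof -
    have "x \<notin> tree_ball d n" if "x \<notin> ?D" for x
      using that tree_ball_mono[of n "Suc n" d] by auto
    then have "s x = \<sigma> x" "s' x = \<sigma>' x" if "x \<notin> ?D" for x
      using off that by blast+
    then show "s \<in> extensional ?D \<longleftrightarrow> \<sigma> \<in> extensional ?D" "s' \<in> extensional ?D \<longleftrightarrow> \<sigma>' \<in> extensional ?D"
      by (auto simp: extensional_def)
  qed
  have ra: "pmf a s * ?w \<sigma> = pmf a \<sigma> * ?w s"
    using \<mu> off(1) ext(1) unfolding ratio_gibbs_def a by auto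
  have rb: "pmf b s' * ?w \<sigma>' = pmf b \<sigma>' * ?w s'"
    using \<nu> off(2) ext(2) unfolding ratio_gibbs_def b by auto
  have w: "?w s * ?w s' = ?w \<sigma> * ?w \<sigma>'"
    using H_sos_swap[of p z, unfolded s] unfolding exp_add[symmetric] ring_distribs(1)[symmetric]
    by (simp add: z)
  have "pmf a s * pmf b s' * (?w \<sigma> * ?w \<sigma>') = (pmf a s * ?w \<sigma>) * (pmf b s' * ?w \<sigma>')" by simp
  also have "\<dots> = pmf a \<sigma> * pmf b \<sigma>' * (?w s * ?w s')" unfolding ra rb by simp
  also have "\<dots> = pmf a \<sigma> * pmf b \<sigma>' * (?w \<sigma> * ?w \<sigma>')" unfolding w ..
  finally have "pmf a s * pmf b s' = pmf a \<sigma> * pmf b \<sigma>'" by simp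
  then have "pmf (pair_pmf a b) (swap z) = pmf (pair_pmf a b) z" by (simp add: z[symmetric] s pmf_pair) (simp add: z pmf_pair)
  moreover have "pmf (map_pmf swap (pair_pmf a b)) (swap (swap z)) = pmf (pair_pmf a b) (swap z)"
    by (rule pmf_map_inj'[OF inj])
  ultimately show "pmf (map_pmf swap (pair_pmf a b)) z = pmf (pair_pmf a b) z" by (simp add: swap_swap)
qed

end

text \<open>When the ball of radius \<open>m\<close> lies in the swap region, the invariant swap
  exchanges the two copies there, so only the complementary event contributes to the difference.
  That event produces a branch from level \<open>m\<close> to level \<open>n\<close> with a
  disagreement at every site. Taking \<open>S\<close> as the sites where the first copy disagrees,
  the second must disagree on the rest, and independence gives the product.\<close>

lemma ratio_gibbs_compare:
  assumes "prob_space \<mu>" "sets \<mu> = sets (Omega d)" and \<mu>: "ratio_gibbs d p \<beta> \<mu>"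
    and "prob_space \<nu>" "sets \<nu> = sets (Omega d)" and \<nu>: "ratio_gibbs d p \<beta> \<nu>" and mn: "m \<le> n"
  defines "branch y \<equiv> (\<lambda>j. take j y) ` {m..n}"
  shows "\<bar>measure \<mu> (cylinder d (tree_ball d m) \<xi>) - measure \<nu> (cylinder d (tree_ball d m) \<xi>)\<bar>
    \<le> (\<Sum>y\<in>{y\<in>cayley_V d. length y = n}. \<Sum>S\<in>Pow (branch y).
        measure \<mu> {\<sigma> \<in> space (Omega d). \<forall>x\<in>S. \<sigma> x \<noteq> \<omega> x} *
        measure \<nu> {\<sigma> \<in> space (Omega d). \<forall>x\<in>branch y - S. \<sigma> x \<noteq> \<omega> x})"
proof -
  define D where "D = tree_ball d (Suc n)"
  have D: "finite D" "D \<subseteq> cayley_V d" using tree_ball_subset by (auto simp: D_def)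
  obtain a where a: "\<And>S. measure (measure_pmf a) S = measure \<mu> {\<sigma> \<in> space (Omega d). restrict \<sigma> D \<in> S}"
    "\<And>\<sigma>. pmf a \<sigma> = (if \<sigma> \<in> extensional D then measure \<mu> (cylinder d D \<sigma>) else 0)"
    using ex_marginal_pmf[OF assms(1,2) D] by blast
  obtain b where b: "\<And>S. measure (measure_pmf b) S = measure \<nu> {\<sigma> \<in> space (Omega d). restrict \<sigma> D \<in> S}"
    "\<And>\<sigma>. pmf b \<sigma> = (if \<sigma> \<in> extensional D then measure \<nu> (cylinder d D \<sigma>) else 0)"
    using ex_marginal_pmf[OF assms(4,5) D] by blast
  let ?T = "swap d n \<omega>" and ?R = "swap_region d n \<omega>" and ?B = "tree_ball d m"
  define pp where "pp = pair_pmf a b"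
  let ?P = "measure (measure_pmf pp)"
  have inv: "map_pmf ?T pp = pp"
    unfolding pp_def by (rule pair_pmf_swap[OF \<mu> \<nu>]) (use a(2) b(2) in \<open>simp_all add: D_def\<close>)
  define A where "A = {\<sigma>. \<forall>x\<in>?B. \<sigma> x = \<xi> x}"
  define good where "good = {z. ?B \<subseteq> ?R z}"
  have BD: "?B \<subseteq> D" unfolding D_def using mn by (intro tree_ball_mono) simp
  have "?P {z \<in> good. snd z \<in> A} = measure (measure_pmf (map_pmf ?T pp)) {z \<in> good. snd z \<in> A}"
    by (simp add: inv)
  also have "\<dots> = ?P (?T -` {z \<in> good. snd z \<in> A})" by (simp add: measure_map_pmf)
  also have "?T -` {z \<in> good. snd z \<in> A} = {z \<in> good. fst z \<in> A}"
  proof -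
    have "snd (?T z) x = fst z x" if "z \<in> good" "x \<in> ?B" for z x
      using that by (auto simp: good_def swap_def)
    then have "snd (?T z) \<in> A \<longleftrightarrow> fst z \<in> A" if "z \<in> good" for z
      using that by (simp add: A_def)
    moreover have "?T z \<in> good \<longleftrightarrow> z \<in> good" for z by (simp add: good_def swap_region_swap)
    ultimately show ?thesis by auto
  qed
  finally have good_eq: "?P {z \<in> good. fst z \<in> A} = ?P {z \<in> good. snd z \<in> A}" ..
  have split: "?P {z. Q z} = ?P {z \<in> good. Q z} + ?P {z. z \<notin> good \<and> Q z}" for Q
    by (subst measure_pmf.finite_measure_Union[symmetric]) (auto intro: arg_cong[where f = "measure _"])
  have small: "?P {z. z \<notin> good \<and> Q z} \<le> ?P (- good)" for Q
    by (rule measure_pmf.finite_measure_mono) auto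
  have marg_a: "?P {z. fst z \<in> S} = measure (measure_pmf a) S" for S
  proof -
    have "{z :: (nat list \<Rightarrow> int) \<times> (nat list \<Rightarrow> int). fst z \<in> S} = S \<times> UNIV" by auto
    then show ?thesis unfolding pp_def by (simp add: measure_pair_pmf_Times)
  qed
  have marg_b: "?P {z. snd z \<in> S} = measure (measure_pmf b) S" for S
  proof -
    have "{z :: (nat list \<Rightarrow> int) \<times> (nat list \<Rightarrow> int). snd z \<in> S} = UNIV \<times> S" by auto
    then show ?thesis unfolding pp_def by (simp add: measure_pair_pmf_Times)
  qed
  have cyl: "{\<sigma> \<in> space (Omega d). restrict \<sigma> D \<in> A} = cylinder d ?B \<xi>"
    using BD by (auto simp: A_def cylinder_def subset_iff)
  have "measure \<mu> (cylinder d ?B \<xi>) = ?P {z. fst z \<in> A}" "measure \<nu> (cylinder d ?B \<xi>) = ?P {z. snd z \<in> A}"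
    unfolding marg_a marg_b a(1) b(1) cyl by simp_all
  then have "\<bar>measure \<mu> (cylinder d ?B \<xi>) - measure \<nu> (cylinder d ?B \<xi>)\<bar>
      = \<bar>?P {z. z \<notin> good \<and> fst z \<in> A} - ?P {z. z \<notin> good \<and> snd z \<in> A}\<bar>"
    using split[of "\<lambda>z. fst z \<in> A"] split[of "\<lambda>z. snd z \<in> A"] good_eq by simp
  also have "\<dots> \<le> ?P (- good)"
    using small[of "\<lambda>z. fst z \<in> A"] small[of "\<lambda>z. snd z \<in> A"]
      measure_nonneg[of pp "{z. z \<notin> good \<and> fst z \<in> A}"] measure_nonneg[of pp "{z. z \<notin> good \<and> snd z \<in> A}"]
    unfolding abs_le_iff by linarith
  also have "\<dots> \<le> (\<Sum>y\<in>{y\<in>cayley_V d. length y = n}. \<Sum>S\<in>Pow (branch y).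
      ?P ({\<sigma>. \<forall>x\<in>S. \<sigma> x \<noteq> \<omega> x} \<times> {\<sigma>. \<forall>x\<in>branch y - S. \<sigma> x \<noteq> \<omega> x}))"
  proof -
    let ?Y = "{y\<in>cayley_V d. length y = n}"
    let ?E = "\<lambda>y S. {\<sigma>. \<forall>x\<in>S. \<sigma> x \<noteq> \<omega> x} \<times> {\<sigma>. \<forall>x\<in>branch y - S. \<sigma> x \<noteq> \<omega> x}"
    have Y: "finite ?Y" by (rule finite_subset[OF _ finite_tree_ball[of d n]]) (auto simp: tree_ball_def)
    have branch: "finite (branch y)" for y by (simp add: branch_def)
    have "- good \<subseteq> (\<Union>y\<in>?Y. \<Union>S\<in>Pow (branch y). ?E y S)"
    proof
      fix z assume "z \<in> - good"
      then obtain y where y: "y \<in> ?Y" "\<And>x. x \<in> branch y \<Longrightarrow> disagree \<omega> z x"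
        using swap_region_ball[of d m n \<omega> z, OF _ mn] by (auto simp: good_def branch_def)
      have "snd z x \<noteq> \<omega> x" if "x \<in> branch y" "x \<notin> {x \<in> branch y. fst z x \<noteq> \<omega> x}" for x
        using y(2)[OF that(1)] that by (simp add: disagree_def)
      then have "z \<in> ?E y {x \<in> branch y. fst z x \<noteq> \<omega> x}"
        unfolding mem_Times_iff by blast
      moreover have "{x \<in> branch y. fst z x \<noteq> \<omega> x} \<in> Pow (branch y)" by auto
      ultimately have "z \<in> (\<Union>S\<in>Pow (branch y). ?E y S)" by (rule UN_I[rotated])
      then show "z \<in> (\<Union>y\<in>?Y. \<Union>S\<in>Pow (branch y). ?E y S)" by (rule UN_I[OF y(1)])
    qed
    then have "?P (- good) \<le> ?P (\<Union>y\<in>?Y. \<Union>S\<in>Pow (branch y). ?E y S)"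
      by (intro measure_pmf.finite_measure_mono) auto
    also have "\<dots> \<le> (\<Sum>y\<in>?Y. ?P (\<Union>S\<in>Pow (branch y). ?E y S))"
      by (rule measure_pmf.finite_measure_subadditive_finite[OF Y]) auto
    also have "\<dots> \<le> (\<Sum>y\<in>?Y. \<Sum>S\<in>Pow (branch y). ?P (?E y S))"
      by (intro sum_mono measure_pmf.finite_measure_subadditive_finite) (auto simp: branch)
    finally show ?thesis .
  qed
  also have "\<dots> = (\<Sum>y\<in>{y\<in>cayley_V d. length y = n}. \<Sum>S\<in>Pow (branch y).
        measure \<mu> {\<sigma> \<in> space (Omega d). \<forall>x\<in>S. \<sigma> x \<noteq> \<omega> x} *
        measure \<nu> {\<sigma> \<in> space (Omega d). \<forall>x\<in>branch y - S. \<sigma> x \<noteq> \<omega> x})"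
  proof (intro sum.cong refl)
    fix y S assume y: "y \<in> {y\<in>cayley_V d. length y = n}" and S: "S \<in> Pow (branch y)"
    have "branch y \<subseteq> D"
      using y take_cayley_V[of y d] by (auto simp: branch_def D_def tree_ball_def)
    then have *: "{\<sigma> \<in> space (Omega d). restrict \<sigma> D \<in> {\<sigma>. \<forall>x\<in>S'. \<sigma> x \<noteq> \<omega> x}}
        = {\<sigma> \<in> space (Omega d). \<forall>x\<in>S'. \<sigma> x \<noteq> \<omega> x}" if "S' \<subseteq> branch y" for S'
      using that by (auto simp: subset_iff)
    show "?P ({\<sigma>. \<forall>x\<in>S. \<sigma> x \<noteq> \<omega> x} \<times> {\<sigma>. \<forall>x\<in>branch y - S. \<sigma> x \<noteq> \<omega> x})
      = measure \<mu> {\<sigma> \<in> space (Omega d). \<forall>x\<in>S. \<sigma> x \<noteq> \<omega> x} *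
        measure \<nu> {\<sigma> \<in> space (Omega d). \<forall>x\<in>branch y - S. \<sigma> x \<noteq> \<omega> x}"
      unfolding pp_def measure_pair_pmf_Times a(1) b(1) using S by (subst (1 2) *) auto
  qed
  finally show ?thesis .
qed

text \<open>A component of a convex decomposition of \<open>\<mu>\<close> is dominated by a multiple of \<open>\<mu>\<close>,
  so deviations from \<open>\<omega>\<close> do not percolate under it either.\<close>

lemma ratio_gibbs_eqI:
  assumes "prob_space \<mu>" "sets \<mu> = sets (Omega d)" "ratio_gibbs d p \<beta> \<mu>"
    and "prob_space \<nu>" "sets \<nu> = sets (Omega d)" "ratio_gibbs d p \<beta> \<nu>"
    and \<epsilon>: "\<epsilon> \<ge> 0" "4 * \<epsilon> * real (d + 1) \<le> 1"
    and small: "\<And>S. finite S \<Longrightarrow> S \<subseteq> cayley_V d \<Longrightarrow>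
        measure \<mu> {\<sigma> \<in> space (Omega d). \<forall>x\<in>S. \<sigma> x \<noteq> \<omega> x} \<le> \<epsilon> ^ card S"
    and dom: "\<And>A. A \<in> sets (Omega d) \<Longrightarrow> measure \<nu> A \<le> C * measure \<mu> A" and C: "C \<ge> 0"
  shows "\<nu> = \<mu>"
proof -
  have meas: "{\<sigma> \<in> space (Omega d). \<forall>x\<in>S. \<sigma> x \<noteq> \<omega> x} \<in> sets (Omega d)"
    if "finite S" "S \<subseteq> cayley_V d" for S
  proof -
    have "{\<sigma> \<in> space (Omega d). \<forall>x\<in>S. \<sigma> x \<noteq> \<omega> x}
      = (\<lambda>\<sigma>. restrict \<sigma> S) -` {\<sigma>. \<forall>x\<in>S. \<sigma> x \<noteq> \<omega> x} \<inter> space (Omega d)" by auto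
    also have "\<dots> \<in> sets (Omega d)"
      by (rule measurable_sets[OF measurable_restrict_finite[OF that]]) simp
    finally show ?thesis .
  qed
  have "measure \<mu> (cylinder d (tree_ball d m) \<xi>) = measure \<nu> (cylinder d (tree_ball d m) \<xi>)" for m \<xi>
  proof -
    define \<Delta> where "\<Delta> = \<bar>measure \<mu> (cylinder d (tree_ball d m) \<xi>) - measure \<nu> (cylinder d (tree_ball d m) \<xi>)\<bar>"
    have bound: "\<Delta> \<le> C * real (d + 1) ^ m * (1 / 2) ^ k" for k
    proof -
      \<comment> \<open>A branch from level \<open>m\<close> to level \<open>m + k\<close> has
        \<open>k + 1\<close> sites, which is the exponent \<open>Suc k\<close> below.\<close>
      define n where "n = m + k"
      let ?path = "\<lambda>y. (\<lambda>j. take j y) ` {m..n}" and ?Y = "{y\<in>cayley_V d. length y = n}"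
      have cardY: "card ?Y \<le> (d + 1) ^ n"
      proof -
        have "card ?Y \<le> card {xs. set xs \<subseteq> {..d} \<and> length xs = n}"
          by (intro card_mono finite_lists_length_eq) (auto simp: cayley_V_def)
        then show ?thesis by (simp add: card_lists_length_eq)
      qed
      have "\<Delta> \<le> (\<Sum>y\<in>?Y. \<Sum>S\<in>Pow (?path y).
        measure \<mu> {\<sigma> \<in> space (Omega d). \<forall>x\<in>S. \<sigma> x \<noteq> \<omega> x} *
        measure \<nu> {\<sigma> \<in> space (Omega d). \<forall>x\<in>?path y - S. \<sigma> x \<noteq> \<omega> x})"
        unfolding \<Delta>_def using assms by (intro ratio_gibbs_compare) (auto simp: n_def)
      \<comment> \<open>Whatever the splitting \<open>S\<close>, the exponents of
        \<open>\<epsilon>\<close> for the two copies add up to \<open>Suc k\<close>; the domination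
        constant \<open>C\<close> enters once.\<close>
      also have "\<dots> \<le> (\<Sum>y\<in>?Y. \<Sum>S\<in>Pow (?path y). C * \<epsilon> ^ Suc k)"
      proof (intro sum_mono)
        fix y S assume y: "y \<in> ?Y" and S: "S \<in> Pow (?path y)"
        have fin: "finite (?path y)" by simp
        have sub: "?path y \<subseteq> cayley_V d" using y take_cayley_V by auto
        have "inj_on (\<lambda>j. take j y) {m..n}"
          using y by (auto simp: inj_on_def dest!: arg_cong[where f = length])
        then have "card (?path y) = Suc k" by (simp add: card_image n_def)
        moreover have "card (?path y) = card S + card (?path y - S)"
          using S fin by (metis Pow_iff card_Diff_subset card_mono finite_subset le_add_diff_inverse)
        ultimately have cards: "card S + card (?path y - S) = Suc k" by simp
        have S': "finite S" "S \<subseteq> cayley_V d" "finite (?path y - S)" "?path y - S \<subseteq> cayley_V d"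
          using S sub fin by (auto intro: finite_subset)
        have "measure \<nu> {\<sigma> \<in> space (Omega d). \<forall>x\<in>?path y - S. \<sigma> x \<noteq> \<omega> x} \<le> C * \<epsilon> ^ card (?path y - S)"
          using dom[OF meas[OF S'(3,4)]] mult_left_mono[OF small[OF S'(3,4)] C] by linarith
        then have "measure \<mu> {\<sigma> \<in> space (Omega d). \<forall>x\<in>S. \<sigma> x \<noteq> \<omega> x} *
            measure \<nu> {\<sigma> \<in> space (Omega d). \<forall>x\<in>?path y - S. \<sigma> x \<noteq> \<omega> x}
          \<le> \<epsilon> ^ card S * (C * \<epsilon> ^ card (?path y - S))"
          using small[OF S'(1,2)] \<epsilon>(1) by (intro mult_mono) auto
        also have "\<dots> = C * \<epsilon> ^ Suc k" by (simp only: cards[symmetric] power_add mult_ac)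
        finally show "measure \<mu> {\<sigma> \<in> space (Omega d). \<forall>x\<in>S. \<sigma> x \<noteq> \<omega> x} *
            measure \<nu> {\<sigma> \<in> space (Omega d). \<forall>x\<in>?path y - S. \<sigma> x \<noteq> \<omega> x} \<le> C * \<epsilon> ^ Suc k" .
      qed
      also have "\<dots> \<le> (\<Sum>y\<in>?Y. 2 ^ Suc k * (C * \<epsilon> ^ Suc k))"
      proof (rule sum_mono)
        fix y assume "y \<in> ?Y"
        have "card (?path y) \<le> Suc k" using card_image_le[of "{m..n}" "\<lambda>j. take j y"] by (simp add: n_def)
        then have "(2::real) ^ card (?path y) \<le> 2 ^ Suc k" by (intro power_increasing) auto
        then have "2 ^ card (?path y) * (C * \<epsilon> ^ Suc k) \<le> 2 ^ Suc k * (C * \<epsilon> ^ Suc k)"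
          using C \<epsilon>(1) by (intro mult_right_mono) auto
        then show "(\<Sum>S\<in>Pow (?path y). C * \<epsilon> ^ Suc k) \<le> 2 ^ Suc k * (C * \<epsilon> ^ Suc k)"
          by (simp add: card_Pow)
      qed
      also have "\<dots> = real (card ?Y) * (2 ^ Suc k * (C * \<epsilon> ^ Suc k))"
        by (rule sum_constant)
      also have "\<dots> \<le> real ((d + 1) ^ n) * (2 ^ Suc k * (C * \<epsilon> ^ Suc k))"
        using C \<epsilon>(1) by (intro mult_right_mono of_nat_mono[OF cardY]) simp
      also have "\<dots> = C * real (d + 1) ^ m * ((2 * \<epsilon> * real (d + 1)) ^ k * (2 * \<epsilon>))"
        by (simp add: n_def power_add power_mult_distrib)
      \<comment> \<open>The condition 4 \<epsilon> (d+1) \<le> 1 makes each of the k factors 2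
        \<epsilon> (d+1) at most 1/2, and the leftover 2 \<epsilon> at most 1.\<close>
      also have "\<dots> \<le> C * real (d + 1) ^ m * ((1 / 2) ^ k * 1)"
      proof (intro mult_left_mono mult_mono power_mono)
        have "4 * \<epsilon> * 1 \<le> 4 * \<epsilon> * real (d + 1)" using \<epsilon>(1) by (intro mult_left_mono) auto
        then show "2 * \<epsilon> \<le> 1" using \<epsilon> by linarith
      qed (use \<epsilon> C in auto)
      finally show ?thesis by simp
    qed
    have "(\<lambda>k. C * real (d + 1) ^ m * (1 / 2) ^ k) \<longlonglongrightarrow> C * real (d + 1) ^ m * 0"
      by (intro tendsto_mult_left LIMSEQ_power_zero) simp
    then have "\<Delta> \<le> 0" using bound by (intro LIMSEQ_le_const) auto
    then show ?thesis by (simp add: \<Delta>_def)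
  qed
  then have eq: "emeasure \<nu> (cylinder d (tree_ball d m) \<xi>) = emeasure \<mu> (cylinder d (tree_ball d m) \<xi>)" for m \<xi>
    using assms(1,4) by (simp add: prob_space.finite_measure finite_measure.emeasure_eq_measure)
  show ?thesis
  proof (rule measure_eqI)
    fix A assume "A \<in> sets \<nu>"
    then have A: "A \<in> F_sub d (cayley_V d - {})" using assms(5) by (simp add: F_sub_full)
    show "emeasure \<nu> A = emeasure \<mu> A"
      by (rule measure_eqI_ball_cylinders[where N = 0 and \<Lambda> = "{}",
            OF prob_space.finite_measure[OF assms(4)] prob_space.finite_measure[OF assms(1)] assms(5,2)])
         (simp_all add: eq A[simplified])
  qed (simp add: assms)
qed

context low_temperature_sos
begin

text \<open>Besides the decay in \<open>k\<close>, the probability of any deviation at one site is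
  recorded with the small constant \<open>2 ^ (d + 2) * \<theta>\<close>; this is what later
  separates the measures of different reference configurations.\<close>

lemma ex_localized_extremal_gibbs:
  assumes small: "4 * (2 ^ (d + 2) * \<theta>) * real (d + 1) \<le> 1"
  shows "\<exists>\<mu>. extremal_gibbs_sos d p \<beta> \<mu> \<and>
    (\<forall>v\<in>cayley_V d. measure \<mu> {\<sigma> \<in> space (Omega d). \<sigma> v \<noteq> \<omega> v} \<le> 2 ^ (d + 2) * \<theta>) \<and>
    (\<forall>v\<in>cayley_V d. \<forall>k. measure \<mu> {\<sigma> \<in> space (Omega d). \<sigma> v - \<omega> v = k} \<le> 2 ^ (d + 2) * exp (- \<beta> * pnorm k))"
proof -
  obtain \<mu> r where \<mu>: "prob_space \<mu>" "sets \<mu> = sets (Omega d)" and r: "strict_mono r"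
    and limit: "\<forall>J R. finite J \<and> J \<subseteq> cayley_V d \<and> (\<forall>u v. (\<forall>x\<in>J. u x = v x) \<longrightarrow> R u = R v) \<longrightarrow>
      (\<lambda>n. prob_n (r n) {u. R u}) \<longlonglongrightarrow> measure \<mu> {\<sigma> \<in> space (Omega d). R (\<lambda>x. \<sigma> x - \<omega> x)}"
    using ex_limit_state by blast
  have lim: "(\<lambda>n. prob_n (r n) {u. R u}) \<longlonglongrightarrow> measure \<mu> {\<sigma> \<in> space (Omega d). R (\<lambda>x. \<sigma> x - \<omega> x)}"
    if "finite J" "J \<subseteq> cayley_V d" "\<And>u v. (\<And>x. x \<in> J \<Longrightarrow> u x = v x) \<Longrightarrow> R u = R v" for J R
    by (rule limit[rule_format, of J]) (use that in blast)
  interpret prob_space \<mu> by fact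
  have nonzero: "measure \<mu> {\<sigma> \<in> space (Omega d). \<forall>x\<in>S. \<sigma> x \<noteq> \<omega> x} \<le> (2 ^ (d + 2) * \<theta>) ^ card S"
    if S: "finite S" "S \<subseteq> cayley_V d" for S
  proof -
    have "(\<lambda>n. prob_n (r n) {u. \<forall>x\<in>S. u x \<noteq> 0}) \<longlonglongrightarrow> measure \<mu> {\<sigma> \<in> space (Omega d). \<forall>x\<in>S. \<sigma> x - \<omega> x \<noteq> 0}"
      by (rule lim[OF S, of "\<lambda>u. \<forall>x\<in>S. u x \<noteq> 0"]) auto
    then have "measure \<mu> {\<sigma> \<in> space (Omega d). \<forall>x\<in>S. \<sigma> x - \<omega> x \<noteq> 0} \<le> (2 ^ (d + 2) * \<theta>) ^ card S"
      by (rule LIMSEQ_le_const2) (use peierls_nonzero[OF S(1)] in auto)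
    then show ?thesis by simp
  qed
  have local: "measure \<mu> {\<sigma> \<in> space (Omega d). \<sigma> v - \<omega> v = k} \<le> 2 ^ (d + 2) * exp (- \<beta> * pnorm k)"
    if v: "v \<in> cayley_V d" for v k
  proof -
    have "(\<lambda>n. prob_n (r n) {u. u v = k}) \<longlonglongrightarrow> measure \<mu> {\<sigma> \<in> space (Omega d). \<sigma> v - \<omega> v = k}"
      by (rule lim[of "{v}" "\<lambda>u. u v = k"]) (use v in auto)
    then show ?thesis
      by (rule LIMSEQ_le_const2) (use peierls_cylinder[of "{v}" _ "\<lambda>_. k"] in auto)
  qed
  have cyl_lim: "(\<lambda>n. prob_n (r n) {u. \<forall>x\<in>D. u x = \<xi> x - \<omega> x}) \<longlonglongrightarrow> measure \<mu> (cylinder d D \<xi>)"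
    if "finite D" "D \<subseteq> cayley_V d" for D \<xi>
  proof -
    have "(\<lambda>n. prob_n (r n) {u. \<forall>x\<in>D. u x = \<xi> x - \<omega> x})
      \<longlonglongrightarrow> measure \<mu> {\<sigma> \<in> space (Omega d). \<forall>x\<in>D. \<sigma> x - \<omega> x = \<xi> x - \<omega> x}"
      by (rule lim[OF that, of "\<lambda>u. \<forall>x\<in>D. u x = \<xi> x - \<omega> x"]) auto
    then show ?thesis by (simp add: cylinder_def)
  qed
  have ratio: "ratio_gibbs d p \<beta> \<mu>"
    unfolding ratio_gibbs_def
  proof (intro allI impI)
    fix N and \<xi> \<xi>' :: "nat list \<Rightarrow> int"
    assume eq: "\<forall>x. x \<notin> ball N \<longrightarrow> \<xi> x = \<xi>' x"
    let ?P = "\<lambda>n \<xi>. prob_n (r n) {u. \<forall>x\<in>ball (Suc N). u x = \<xi> x - \<omega> x}"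
    let ?w = "\<lambda>\<xi>. exp (- \<beta> * H_sos d p (ball N) \<xi>)"
    \<comment> \<open>Once the volume contains the ball of radius \<open>N\<close> the ratio
      equation holds exactly. Only two cylinder probabilities and fixed factors occur, so it passes
      to the limit.\<close>
    have "?P n \<xi> * ?w \<xi>' = ?P n \<xi>' * ?w \<xi>" if "n \<ge> Suc N" for n
    proof -
      have "Suc N \<le> r n" using that seq_suble[OF r, of n] by linarith
      then have "ball N \<subseteq> ball (r n)" by (intro tree_ball_mono) simp
      then show ?thesis
        using finite_volume_ratio[of "ball N" "r n" "ball (Suc N)" "\<lambda>x. \<xi> x - \<omega> x" "\<lambda>x. \<xi>' x - \<omega> x"]
          eq tree_ball_mono[of N "Suc N" d] tree_adj_tree_ball by auto
    qed
    then have ev: "eventually (\<lambda>n. ?P n \<xi> * ?w \<xi>' = ?P n \<xi>' * ?w \<xi>) sequentially"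
      by (auto simp: eventually_sequentially)
    have "(\<lambda>n. ?P n \<xi> * ?w \<xi>') \<longlonglongrightarrow> measure \<mu> (cylinder d (ball (Suc N)) \<xi>) * ?w \<xi>'"
      by (intro tendsto_mult_right cyl_lim tree_ball_subset) simp
    moreover have "(\<lambda>n. ?P n \<xi>' * ?w \<xi>) \<longlonglongrightarrow> measure \<mu> (cylinder d (ball (Suc N)) \<xi>') * ?w \<xi>"
      by (intro tendsto_mult_right cyl_lim tree_ball_subset) simp
    ultimately show "measure \<mu> (cylinder d (ball (Suc N)) \<xi>) * ?w \<xi>' = measure \<mu> (cylinder d (ball (Suc N)) \<xi>') * ?w \<xi>"
      using LIMSEQ_unique tendsto_cong[OF ev] by blast
  qed
  have "extremal_gibbs_sos d p \<beta> \<mu>"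
    unfolding extremal_gibbs_sos_def
  proof (intro conjI allI impI)
    show "gibbs_sos d p \<beta> \<mu>" by (rule ratio_gibbs_imp_gibbs[OF \<mu> ratio])
    \<comment> \<open>Here \<open>s\<close> is the weight of \<open>\<nu>\<close> in a decomposition
      of \<open>\<mu>\<close>; dropping the other component leaves \<open>\<nu>\<close> dominated by
      \<open>\<mu>\<close> with constant \<open>1 / s\<close>. It is used with \<open>t\<close> and
      with \<open>1 - t\<close>.\<close>
    have key: "\<nu> = \<mu>" if \<nu>: "gibbs_sos d p \<beta> \<nu>" and s: "s > 0"
      and dom: "\<And>A. A \<in> sets (Omega d) \<Longrightarrow> s * measure \<nu> A \<le> measure \<mu> A" for \<nu> s
    proof (rule ratio_gibbs_eqI[OF \<mu> ratio _ _ gibbs_imp_ratio_gibbs[OF \<nu>] _ small nonzero])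
      show "prob_space \<nu>" "sets \<nu> = sets (Omega d)" using \<nu> by (auto simp: gibbs_sos_def)
      show "measure \<nu> A \<le> (1 / s) * measure \<mu> A" if "A \<in> sets (Omega d)" for A
        using dom[OF that] s by (simp add: field_simps)
    qed (use s \<theta>(1) in auto)
    fix \<mu>1 \<mu>2 t
    assume asm: "gibbs_sos d p \<beta> \<mu>1 \<and> gibbs_sos d p \<beta> \<mu>2 \<and> 0 < t \<and> t < 1 \<and>
      (\<forall>A \<in> sets (Omega d). measure \<mu> A = t * measure \<mu>1 A + (1 - t) * measure \<mu>2 A)"
    show "\<mu>1 = \<mu>" by (rule key[of \<mu>1 t]) (use asm in auto)
    show "\<mu>2 = \<mu>" by (rule key[of \<mu>2 "1 - t"]) (use asm in auto)
  qed
  moreover have "measure \<mu> {\<sigma> \<in> space (Omega d). \<sigma> v \<noteq> \<omega> v} \<le> 2 ^ (d + 2) * \<theta>" if "v \<in> cayley_V d" for v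
    using nonzero[of "{v}"] that by simp
  ultimately show ?thesis using local by blast
qed

end

section \<open>Thresholds for d and beta, and the family of measures\<close>

theorem theorem1:
  fixes p :: real and M dmax :: nat
  assumes "p > 0"
  shows "\<exists>d0::nat. \<forall>d::nat. d \<ge> d0 \<and> d \<ge> 2 \<and> dmax \<le> d \<longrightarrow>
    (\<exists>\<beta>0::real. \<forall>\<beta>::real. \<beta> \<ge> \<beta>0 \<longrightarrow>
      (\<exists>\<mu> :: (nat list \<Rightarrow> int) \<Rightarrow> (nat list \<Rightarrow> int) measure.
         (\<forall>\<omega>0 \<in> G0 dmax d M. gibbs_sos d p \<beta> (\<mu> \<omega>0)) \<and>
         (\<forall>\<omega>0 \<in> G0 dmax d M. \<forall>\<tau>0 \<in> G0 dmax d M. \<omega>0 \<noteq> \<tau>0 \<longrightarrow> \<mu> \<omega>0 \<noteq> \<mu> \<tau>0) \<and>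
         (\<forall>\<omega>0 \<in> G0 dmax d M. extremal_gibbs_sos d p \<beta> (\<mu> \<omega>0)) \<and>
         (\<forall>\<omega>0 \<in> G0 dmax d M. \<exists>c C::real. c > 0 \<and> C > 0 \<and>
            (\<forall>v \<in> cayley_V d. \<forall>k::int.
               measure (\<mu> \<omega>0) {\<sigma> \<in> space (Omega d). \<sigma> v - \<omega>0 v = k}
                 \<le> C * exp (- c * \<beta> * (\<bar>real_of_int k\<bar> powr p))))))"
proof (rule exI[of _ "nat \<lceil>real dmax + 2 powr p * (2 + real dmax * real M powr p)\<rceil>"], intro allI impI)
  fix d :: nat
  assume d: "nat \<lceil>real dmax + 2 powr p * (2 + real dmax * real M powr p)\<rceil> \<le> d \<and> 2 \<le> d \<and> dmax \<le> d"
  \<comment> \<open>The threshold for \<open>d\<close> is the excess-energy condition, rounded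
    up.\<close>
  then have d_large: "real dmax + 2 powr p * (2 + real dmax * real M powr p) \<le> real d"
    by linarith
  \<comment> \<open>With \<epsilon> = 2^(d+2) \<theta>, this choice gives 4 \<epsilon> (d+1) = 1,
    the case of equality in the branch count. It does not involve \<omega>0, so one \<beta>0 serves
    the whole family.\<close>
  define \<theta> :: real where "\<theta> = 1 / (4 * 2 ^ (d + 2) * real (d + 1))"
  have \<theta>: "\<theta> > 0" "4 * (2 ^ (d + 2) * \<theta>) * real (d + 1) = 1"
    by (simp_all add: \<theta>_def)
  then have \<theta>_quarter: "2 ^ (d + 2) * \<theta> \<le> 1 / 4"
    by (simp add: \<theta>_def field_simps)
  obtain \<beta>0 where \<beta>0: "\<beta>0 > 0" "\<And>\<beta>. \<beta> \<ge> \<beta>0 \<Longrightarrow>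
      (\<integral>\<^sup>+k. ennreal (exp (- \<beta> * \<bar>real_of_int k\<bar> powr p)) \<partial>count_space (- {0::int})) \<le> ennreal \<theta>"
    using exp_powr_int_tail_small[OF assms \<theta>(1)] by auto
  show "\<exists>\<beta>0::real. \<forall>\<beta>::real. \<beta> \<ge> \<beta>0 \<longrightarrow>
      (\<exists>\<mu> :: (nat list \<Rightarrow> int) \<Rightarrow> (nat list \<Rightarrow> int) measure.
         (\<forall>\<omega>0 \<in> G0 dmax d M. gibbs_sos d p \<beta> (\<mu> \<omega>0)) \<and>
         (\<forall>\<omega>0 \<in> G0 dmax d M. \<forall>\<tau>0 \<in> G0 dmax d M. \<omega>0 \<noteq> \<tau>0 \<longrightarrow> \<mu> \<omega>0 \<noteq> \<mu> \<tau>0) \<and>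
         (\<forall>\<omega>0 \<in> G0 dmax d M. extremal_gibbs_sos d p \<beta> (\<mu> \<omega>0)) \<and>
         (\<forall>\<omega>0 \<in> G0 dmax d M. \<exists>c C::real. c > 0 \<and> C > 0 \<and>
            (\<forall>v \<in> cayley_V d. \<forall>k::int.
               measure (\<mu> \<omega>0) {\<sigma> \<in> space (Omega d). \<sigma> v - \<omega>0 v = k}
                 \<le> C * exp (- c * \<beta> * (\<bar>real_of_int k\<bar> powr p)))))"
  proof (intro exI[of _ \<beta>0] allI impI)
    fix \<beta> :: real assume "\<beta>0 \<le> \<beta>"
    have "low_temperature_sos d dmax M p \<beta> \<theta> \<omega>0" if "\<omega>0 \<in> G0 dmax d M" for \<omega>0
      using assms that \<beta>0 \<open>\<beta>0 \<le> \<beta>\<close> d_large \<theta>(1) \<theta>_quarter by unfold_locales auto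
    from low_temperature_sos.ex_localized_extremal_gibbs[OF this eq_refl[OF \<theta>(2)]]
    have "\<forall>\<omega>0 \<in> G0 dmax d M. \<exists>\<mu>. extremal_gibbs_sos d p \<beta> \<mu> \<and>
      (\<forall>v\<in>cayley_V d. measure \<mu> {\<sigma> \<in> space (Omega d). \<sigma> v \<noteq> \<omega>0 v} \<le> 2 ^ (d + 2) * \<theta>) \<and>
      (\<forall>v\<in>cayley_V d. \<forall>k. measure \<mu> {\<sigma> \<in> space (Omega d). \<sigma> v - \<omega>0 v = k}
        \<le> 2 ^ (d + 2) * exp (- \<beta> * \<bar>real_of_int k\<bar> powr p))"
      by (rule ballI)
    from bchoice[OF this] obtain \<mu> where "\<forall>\<omega>0 \<in> G0 dmax d M. extremal_gibbs_sos d p \<beta> (\<mu> \<omega>0) \<and>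
      (\<forall>v\<in>cayley_V d. measure (\<mu> \<omega>0) {\<sigma> \<in> space (Omega d). \<sigma> v \<noteq> \<omega>0 v} \<le> 2 ^ (d + 2) * \<theta>) \<and>
      (\<forall>v\<in>cayley_V d. \<forall>k. measure (\<mu> \<omega>0) {\<sigma> \<in> space (Omega d). \<sigma> v - \<omega>0 v = k}
        \<le> 2 ^ (d + 2) * exp (- \<beta> * \<bar>real_of_int k\<bar> powr p))"
      by (rule exE)
    then have \<mu>: "\<And>\<omega>0. \<omega>0 \<in> G0 dmax d M \<Longrightarrow> extremal_gibbs_sos d p \<beta> (\<mu> \<omega>0)"
      and near: "\<And>\<omega>0 v. \<omega>0 \<in> G0 dmax d M \<Longrightarrow> v \<in> cayley_V d \<Longrightarrow>
        measure (\<mu> \<omega>0) {\<sigma> \<in> space (Omega d). \<sigma> v \<noteq> \<omega>0 v} \<le> 2 ^ (d + 2) * \<theta>"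
      and local: "\<And>\<omega>0 v k. \<omega>0 \<in> G0 dmax d M \<Longrightarrow> v \<in> cayley_V d \<Longrightarrow>
        measure (\<mu> \<omega>0) {\<sigma> \<in> space (Omega d). \<sigma> v - \<omega>0 v = k} \<le> 2 ^ (d + 2) * exp (- \<beta> * \<bar>real_of_int k\<bar> powr p)"
      by blast+
    have gibbs: "gibbs_sos d p \<beta> (\<mu> \<omega>0)" if "\<omega>0 \<in> G0 dmax d M" for \<omega>0
      using \<mu>[OF that] by (simp add: extremal_gibbs_sos_def)
    have inj: "\<mu> \<omega>0 \<noteq> \<mu> \<tau>0" if G: "\<omega>0 \<in> G0 dmax d M" "\<tau>0 \<in> G0 dmax d M" and "\<omega>0 \<noteq> \<tau>0" for \<omega>0 \<tau>0
    proof
      assume eq: "\<mu> \<omega>0 = \<mu> \<tau>0"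
      have "\<omega>0 \<in> PiE (cayley_V d) (\<lambda>_. UNIV)" "\<tau>0 \<in> PiE (cayley_V d) (\<lambda>_. UNIV)"
        using G by (auto simp: G0_def)
      with \<open>\<omega>0 \<noteq> \<tau>0\<close> obtain v where v: "v \<in> cayley_V d" "\<omega>0 v \<noteq> \<tau>0 v" by (metis PiE_ext)
      interpret prob_space "\<mu> \<tau>0" using gibbs[OF G(2)] by (simp add: gibbs_sos_def)
      have sets: "sets (\<mu> \<tau>0) = sets (Omega d)" using gibbs[OF G(2)] by (simp add: gibbs_sos_def)
      have meas: "{\<sigma> \<in> space (Omega d). \<sigma> v \<noteq> \<zeta> v} \<in> sets (\<mu> \<tau>0)" for \<zeta> :: "nat list \<Rightarrow> int"
      proof -
        have "{\<sigma> \<in> space (Omega d). \<sigma> v \<in> - {\<zeta> v}} \<in> F_sub d (cayley_V d)"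
          unfolding F_sub_def using v(1) by (intro sigma_sets.Basic) blast
        then show ?thesis by (simp add: sets F_sub_full)
      qed
      \<comment> \<open>A spin at \<open>v\<close> cannot equal both \<open>\<omega>0 v\<close> and
        \<open>\<tau>0 v\<close>. If the measures coincided, two events of probability at most 1/4
        would cover the whole space.\<close>
      have "space (Omega d) = {\<sigma> \<in> space (Omega d). \<sigma> v \<noteq> \<omega>0 v} \<union> {\<sigma> \<in> space (Omega d). \<sigma> v \<noteq> \<tau>0 v}"
        using v(2) by auto
      then have "1 = prob ({\<sigma> \<in> space (Omega d). \<sigma> v \<noteq> \<omega>0 v} \<union> {\<sigma> \<in> space (Omega d). \<sigma> v \<noteq> \<tau>0 v})"
        using prob_space sets_eq_imp_space_eq[OF sets] by simp
      also have "\<dots> \<le> prob {\<sigma> \<in> space (Omega d). \<sigma> v \<noteq> \<omega>0 v} + prob {\<sigma> \<in> space (Omega d). \<sigma> v \<noteq> \<tau>0 v}"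
        by (rule measure_Un_le[OF meas meas])
      also have "\<dots> \<le> 1 / 4 + 1 / 4"
        using near[OF G(1) v(1)] near[OF G(2) v(1)] \<theta>_quarter by (simp add: eq)
      finally show False by simp
    qed
    have decay: "\<exists>c C::real. c > 0 \<and> C > 0 \<and> (\<forall>v \<in> cayley_V d. \<forall>k::int.
        measure (\<mu> \<omega>0) {\<sigma> \<in> space (Omega d). \<sigma> v - \<omega>0 v = k} \<le> C * exp (- c * \<beta> * (\<bar>real_of_int k\<bar> powr p)))"
      if "\<omega>0 \<in> G0 dmax d M" for \<omega>0
      \<comment> \<open>The rate is c = 1, and C = 2^(d+2) is the prefactor of the Peierls bound for
        a single site.\<close>
      using local[OF that] by (intro exI[of _ 1] exI[of _ "2 ^ (d + 2)"]) simp
    show "\<exists>\<mu> :: (nat list \<Rightarrow> int) \<Rightarrow> (nat list \<Rightarrow> int) measure.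
         (\<forall>\<omega>0 \<in> G0 dmax d M. gibbs_sos d p \<beta> (\<mu> \<omega>0)) \<and>
         (\<forall>\<omega>0 \<in> G0 dmax d M. \<forall>\<tau>0 \<in> G0 dmax d M. \<omega>0 \<noteq> \<tau>0 \<longrightarrow> \<mu> \<omega>0 \<noteq> \<mu> \<tau>0) \<and>
         (\<forall>\<omega>0 \<in> G0 dmax d M. extremal_gibbs_sos d p \<beta> (\<mu> \<omega>0)) \<and>
         (\<forall>\<omega>0 \<in> G0 dmax d M. \<exists>c C::real. c > 0 \<and> C > 0 \<and>
            (\<forall>v \<in> cayley_V d. \<forall>k::int.
               measure (\<mu> \<omega>0) {\<sigma> \<in> space (Omega d). \<sigma> v - \<omega>0 v = k}
                 \<le> C * exp (- c * \<beta> * (\<bar>real_of_int k\<bar> powr p))))"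
      using gibbs inj \<mu> decay by (intro exI[of _ \<mu>] conjI ballI impI)
  qed
qed

end
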